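(* Let $\alpha,\beta$ be two nonconstant inner functions and let $\varphi\in L^2(\partial\mathbb{D})$ be such that the asymmetric truncated Toeplitz operator $A^{\alpha,\beta}_{\varphi}\colon K_\alpha\to K_\beta$ is bounded. Then $A^{\alpha,\beta}_{\varphi}=0$ if and only if $\varphi\in \overline{\alpha H^2}+\beta H^2$, i.e. $\varphi=\overline{\alpha h_1}+\beta h_2$ for some $h_1,h_2\in H^2$.
   Context: $H^2$ is the Hardy space of the unit disk $\mathbb{D}$, identified via boundary values with the closed subspace of $L^2(\partial\mathbb{D})$ of functions with vanishing negative Fourier coefficients; $H^\infty$ is the algebra of bounded analytic functions on $\mathbb{D}$. An inner function is $\alpha\in H^\infty$ with $|\alpha|=1$ a.e. on $\partial\mathbb{D}$. The model space is $K_\alpha=H^2\ominus\alpha H^2$, with reproducing kernel $k_w^\alpha(z)=\frac{1-\overline{\alpha(w)}\alpha(z)}{1-\overline{w}z}$, and $K_\alpha^\infty=K_\alpha\cap H^\infty$ (dense in $K_\alpha$). $P_\beta$ is the orthogonal projection of $L^2(\partial\mathbb{D})$ onto $K_\beta$, extended to $f\in L^1(\partial\mathbb{D})$ by $P_\beta f(z)=\langle f,k_z^\beta\rangle$ (an analytic function on $\mathbb{D}$). For inner $\alpha,\beta$ and $\varphi\in L^2(\partial\mathbb{D})$, the asymmetric truncated Toeplitz operator $A^{\alpha,\beta}_\varphi$ is the densely defined operator $A^{\alpha,\beta}_\varphi f=P_\beta(\varphi f)$, $f\in K_\alpha^\infty$; it is called bounded if it extends to a bounded operator $K_\alpha\to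 K_\beta$. *)

theory Defs
  imports "HOL-Analysis.Analysis"
begin

text \<open>Functions on the unit circle are represented as f :: complex \<Rightarrow> complex, of which
only the values f (cis t), t \<in> [0, 2 pi], matter. Lebesgue measure on the circle is the
pushforward of dt/(2 pi) on [0, 2 pi].\<close>

definition circ_int :: "(complex \<Rightarrow> complex) \<Rightarrow> complex" where
  "circ_int f = (LINT t:{0..2*pi}|lborel. f (cis t)) / (2 * pi)"

definition circ_ae :: "(complex \<Rightarrow> bool) \<Rightarrow> bool" where
  "circ_ae P \<longleftrightarrow> (AE t\<in>{0..2*pi} in lborel. P (cis t))"

definition L2_circ :: "(complex \<Rightarrow> complex) \<Rightarrow> bool" where
  "L2_circ f \<longleftrightarrow> set_borel_measurable lborel {0..2*pi} (\<lambda>t. f (cis t)) \<and>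
     set_integrable lborel {0..2*pi} (\<lambda>t. (cmod (f (cis t)))\<^sup>2)"

definition ip_circ :: "(complex \<Rightarrow> complex) \<Rightarrow> (complex \<Rightarrow> complex) \<Rightarrow> complex" where
  "ip_circ f g = circ_int (\<lambda>z. f z * cnj (g z))"

definition normsq_circ :: "(complex \<Rightarrow> complex) \<Rightarrow> real" where
  "normsq_circ f = (LINT t:{0..2*pi}|lborel. (cmod (f (cis t)))\<^sup>2) / (2 * pi)"

definition fourier_coeff :: "(complex \<Rightarrow> complex) \<Rightarrow> int \<Rightarrow> complex" where
  "fourier_coeff f n = circ_int (\<lambda>z. f z * z powi (- n))"

definition H2 :: "(complex \<Rightarrow> complex) \<Rightarrow> bool" where
  "H2 f \<longleftrightarrow> L2_circ f \<and> (\<forall>n<0. fourier_coeff f n = 0)"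

definition Hinf :: "(complex \<Rightarrow> complex) \<Rightarrow> bool" where
  "Hinf f \<longleftrightarrow> H2 f \<and> (\<exists>B. circ_ae (\<lambda>z. cmod (f z) \<le> B))"

definition inner_fun :: "(complex \<Rightarrow> complex) \<Rightarrow> bool" where
  "inner_fun a \<longleftrightarrow> Hinf a \<and> circ_ae (\<lambda>z. cmod (a z) = 1)"

definition nonconstant :: "(complex \<Rightarrow> complex) \<Rightarrow> bool" where
  "nonconstant a \<longleftrightarrow> \<not> (\<exists>c. circ_ae (\<lambda>z. a z = c))"

text \<open>Analytic extension to the disk of a boundary function (Cauchy integral);
for f in H^2 this is the function z \<mapsto> sum of fourier_coeff f n z^n.\<close>
definition ext_disk :: "(complex \<Rightarrow> complex) \<Rightarrow> complex \<Rightarrow> complex" where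
  "ext_disk f w = circ_int (\<lambda>z. f z / (1 - w * cnj z))"

definition model_space :: "(complex \<Rightarrow> complex) \<Rightarrow> (complex \<Rightarrow> complex) \<Rightarrow> bool" where
  "model_space a f \<longleftrightarrow> H2 f \<and> (\<forall>h. H2 h \<longrightarrow> ip_circ f (\<lambda>z. a z * h z) = 0)"

definition model_space_inf :: "(complex \<Rightarrow> complex) \<Rightarrow> (complex \<Rightarrow> complex) \<Rightarrow> bool" where
  "model_space_inf a f \<longleftrightarrow> model_space a f \<and> Hinf f"

definition repr_kernel :: "(complex \<Rightarrow> complex) \<Rightarrow> complex \<Rightarrow> complex \<Rightarrow> complex" where
  "repr_kernel a w z = (1 - cnj (ext_disk a w) * a z) / (1 - cnj w * z)"

text \<open>P_b g (w) = <g, k_w^b>, an analytic function on the disk.\<close>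
definition proj_model :: "(complex \<Rightarrow> complex) \<Rightarrow> (complex \<Rightarrow> complex) \<Rightarrow> complex \<Rightarrow> complex" where
  "proj_model b g w = ip_circ g (repr_kernel b w)"

definition atto :: "(complex \<Rightarrow> complex) \<Rightarrow> (complex \<Rightarrow> complex) \<Rightarrow> (complex \<Rightarrow> complex)
    \<Rightarrow> (complex \<Rightarrow> complex) \<Rightarrow> complex \<Rightarrow> complex" where
  "atto a b phi f = proj_model b (\<lambda>z. phi z * f z)"

text \<open>Boundedness: the H^2 norm (sup over r of the integral means of |F(r e^{it})|^2)
of A f is bounded by C times the L^2 norm of f, for f in K_a^\<infinity>.\<close>
definition atto_bounded :: "(complex \<Rightarrow> complex) \<Rightarrow> (complex \<Rightarrow> complex) \<Rightarrow> (complex \<Rightarrow> complex) \<Rightarrow> bool" where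
  "atto_bounded a b phi \<longleftrightarrow> (\<exists>C. \<forall>f. model_space_inf a f \<longrightarrow>
     (\<forall>r. 0 < r \<and> r < 1 \<longrightarrow>
        (LINT t:{0..2*pi}|lborel. (cmod (atto a b phi f (of_real r * cis t)))\<^sup>2) / (2 * pi)
          \<le> C * normsq_circ f))"

end

theory Submission
  imports Defs
begin

text \<open>
  If \<open>\<phi> = cnj (\<alpha> h\<^sub>1) + \<beta> h\<^sub>2\<close>, then for bounded \<open>f\<close> in \<open>K\<^sub>\<alpha>\<close> and a kernel \<open>k\<close> of \<open>K\<^sub>\<beta>\<close> the number
  \<open>\<langle>\<phi> f, k\<rangle>\<close> splits into \<open>\<langle>f, \<alpha> h\<^sub>1 k\<rangle>\<close> and \<open>\<langle>\<beta> h\<^sub>2 f, k\<rangle>\<close>, and both vanish.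

  Conversely, let \<open>A = 0\<close>, so that \<open>\<langle>\<phi> f, g\<rangle> = 0\<close> for all bounded \<open>f\<close> in \<open>K\<^sub>\<alpha>\<close> and \<open>g\<close> in \<open>K\<^sub>\<beta>\<close>. Both
  spaces are invariant under the backward shift \<open>S f = (f - f(0)) / z\<close>; expanding \<open>\<langle>\<phi> S f, S g\<rangle> = 0\<close>
  gives \<open>f(0) \<langle>\<phi>, g\<rangle> + cnj (g(0)) \<integral>\<phi> f = f(0) cnj (g(0)) c\<^sub>0\<close> with \<open>c\<^sub>0 = \<integral>\<phi>\<close>. Inserting the kernels at
  the origin, which do not vanish there because the inner functions are nonconstant, yields
  constants with \<open>c + d = c\<^sub>0\<close>, \<open>\<integral>\<phi> f = c f(0)\<close> and \<open>\<langle>\<phi>, g\<rangle> = d cnj (g(0))\<close>. So \<open>\<phi> - d\<close> is orthogonal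
  to the kernels of \<open>K\<^sub>\<beta>\<close> and \<open>cnj \<phi> - cnj c\<close> to those of \<open>K\<^sub>\<alpha>\<close>. Orthogonality of \<open>F\<close> to all kernels of
  \<open>K\<^sub>\<beta>\<close> says \<open>F\<^sub>+ = \<beta> h\<close> with \<open>h\<close> the Riesz projection of \<open>cnj \<beta> F\<close>, where \<open>F\<^sub>+\<close> is that of \<open>F\<close>; this
  produces \<open>h\<^sub>2\<close> and \<open>h\<^sub>1\<close>, and comparing Fourier coefficients finishes the proof.
\<close>

subsection \<open>Completeness of square-integrable functions\<close>

text \<open>
  The limit is given as a pointwise limit along a subsequence: for functions of the form
  \<open>t \<mapsto> u n (cis t)\<close> it is then again a function of \<open>cis t\<close>.
\<close>
lemma L2_complete:
  fixes u :: "nat \<Rightarrow> 'a \<Rightarrow> complex"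
  assumes [measurable]: "\<And>n. u n \<in> borel_measurable M"
    and Cauchy: "\<And>e::real. e > 0 \<Longrightarrow>
      \<exists>N. \<forall>m\<ge>N. \<forall>n\<ge>N. (\<integral>\<^sup>+x. ennreal ((cmod (u m x - u n x))\<^sup>2) \<partial>M) \<le> ennreal e"
  shows "\<exists>r. \<forall>e>0. \<exists>N. \<forall>n\<ge>N.
      (\<integral>\<^sup>+x. ennreal ((cmod (u n x - lim (\<lambda>k. u (r k) x)))\<^sup>2) \<partial>M) \<le> ennreal e"
proof -
  have "\<forall>k. \<exists>N. \<forall>m\<ge>N. \<forall>n\<ge>N.
      (\<integral>\<^sup>+x. ennreal ((cmod (u m x - u n x))\<^sup>2) \<partial>M) \<le> ennreal ((1/4)^k)"
    by (intro allI Cauchy) auto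
  then obtain N where N: "\<And>k m n. m \<ge> N k \<Longrightarrow> n \<ge> N k \<Longrightarrow>
      (\<integral>\<^sup>+x. ennreal ((cmod (u m x - u n x))\<^sup>2) \<partial>M) \<le> ennreal ((1/4)^k)"
    by metis
  \<comment> \<open>Partial sums of \<open>Suc (N i)\<close> dominate every \<open>N k\<close> and
    increase strictly, so consecutive \<open>u (r k)\<close> differ by at most
    \<open>(1/4)^k\<close> in squared norm.\<close>
  define r where "r k = (\<Sum>i\<le>k. Suc (N i))" for k
  have rN: "N k \<le> r k" for k
    unfolding r_def using member_le_sum[of k "{..k}" "\<lambda>i. Suc (N i)"] by simp
  have rSuc: "r k < r (Suc k)" for k
    unfolding r_def by simp
  have rmono: "strict_mono r"
    using rSuc by (simp add: strict_mono_Suc_iff)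
  define d where "d k x = u (r (Suc k)) x - u (r k) x" for k x
  have [measurable]: "d k \<in> borel_measurable M" for k
    unfolding d_def by measurable
  \<comment> \<open>The weight \<open>2^k\<close> still leaves the summable bound
    \<open>(1/2)^k\<close>. Weighted squares, unlike plain ones, control the sum of the increments
    themselves.\<close>
  have d: "(\<integral>\<^sup>+x. ennreal (2^k * (cmod (d k x))\<^sup>2) \<partial>M) \<le> ennreal ((1/2)^k)" for k
  proof -
    have "(\<integral>\<^sup>+x. ennreal ((cmod (d k x))\<^sup>2) \<partial>M) \<le> ennreal ((1/4)^k)"
      unfolding d_def using rN[of k] rSuc[of k] by (intro N) auto
    then have "ennreal (2^k) * (\<integral>\<^sup>+x. ennreal ((cmod (d k x))\<^sup>2) \<partial>M)
        \<le> ennreal (2^k) * ennreal ((1/4)^k)"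
      by (rule mult_left_mono) auto
    also have "\<dots> = ennreal ((1/2)^k)"
      by (simp flip: ennreal_mult power_mult_distrib)
    also have "ennreal (2^k) * (\<integral>\<^sup>+x. ennreal ((cmod (d k x))\<^sup>2) \<partial>M)
        = (\<integral>\<^sup>+x. ennreal (2^k * (cmod (d k x))\<^sup>2) \<partial>M)"
      by (subst nn_integral_cmult[symmetric]) (auto simp: ennreal_mult)
    finally show ?thesis .
  qed
  have "(\<integral>\<^sup>+x. (\<Sum>k. ennreal (2^k * (cmod (d k x))\<^sup>2)) \<partial>M)
      = (\<Sum>k. \<integral>\<^sup>+x. ennreal (2^k * (cmod (d k x))\<^sup>2) \<partial>M)"
    by (rule nn_integral_suminf) measurable
  also have "\<dots> \<le> (\<Sum>k. ennreal ((1/2)^k))"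
    by (intro suminf_le d) auto
  also have "\<dots> < \<infinity>"
    by (subst suminf_ennreal2) (auto intro!: summable_geometric)
  finally have fin: "(\<integral>\<^sup>+x. (\<Sum>k. ennreal (2^k * (cmod (d k x))\<^sup>2)) \<partial>M) \<noteq> \<infinity>"
    by simp
  have "AE x in M. (\<Sum>k. ennreal (2^k * (cmod (d k x))\<^sup>2)) \<noteq> \<infinity>"
    using fin by (intro nn_integral_PInf_AE) measurable
  then have conv: "AE x in M. (\<lambda>k. u (r k) x) \<longlonglongrightarrow> lim (\<lambda>k. u (r k) x)"
  proof eventually_elim
    case (elim x)
    then have s: "summable (\<lambda>k. 2^k * (cmod (d k x))\<^sup>2)"
      by (intro summable_suminf_not_top) auto
    \<comment> \<open>Expanding the square of \<open>1 - c * cmod (d k x)\<close> with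
      \<open>c = 2^k\<close> bounds the increment by a geometric term plus the weighted square; the
      telescoping series thus converges absolutely.\<close>
    have le: "norm (norm (d k x)) \<le> (1/2)^k + 2^k * (cmod (d k x))\<^sup>2" for k
    proof -
      define c :: real where "c = 2^k"
      have c: "c > 0" "(1/2)^k = 1/c"
        unfolding c_def by (auto simp: power_one_over)
      have "0 \<le> (1 - c * cmod (d k x))\<^sup>2" by simp
      then have "2 * c * cmod (d k x) \<le> 1 + c\<^sup>2 * (cmod (d k x))\<^sup>2"
        by (simp add: power2_diff power_mult_distrib)
      moreover have "0 \<le> c * cmod (d k x)" using c by simp
      ultimately have "c * cmod (d k x) \<le> 1 + c\<^sup>2 * (cmod (d k x))\<^sup>2" by linarith
      then have "cmod (d k x) \<le> 1/c + c * (cmod (d k x))\<^sup>2"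
        using c by (simp add: field_simps power2_eq_square)
      then show ?thesis using c by (simp add: c_def)
    qed
    have "summable (\<lambda>k. norm (d k x))"
      by (rule summable_comparison_test'[OF _ le])
        (intro summable_add s summable_geometric, simp)
    then have "summable (\<lambda>k. d k x)"
      by (rule summable_norm_cancel)
    then have "(\<lambda>n. \<Sum>k<n. d k x) \<longlonglongrightarrow> (\<Sum>k. d k x)"
      by (rule summable_LIMSEQ)
    moreover have "(\<Sum>k<n. d k x) = u (r n) x - u (r 0) x" for n
      unfolding d_def by (rule sum_lessThan_telescope)
    ultimately have "(\<lambda>n. u (r n) x - u (r 0) x + u (r 0) x) \<longlonglongrightarrow> (\<Sum>k. d k x) + u (r 0) x"
      by (intro tendsto_add) auto
    then have "convergent (\<lambda>n. u (r n) x)"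
      by (auto simp: convergent_def)
    then show ?case
      by (simp add: convergent_LIMSEQ_iff)
  qed
  show ?thesis
  proof (intro exI[of _ r] allI impI)
    fix e :: real assume "e > 0"
    then obtain K where K: "\<And>m n. m \<ge> K \<Longrightarrow> n \<ge> K \<Longrightarrow>
        (\<integral>\<^sup>+x. ennreal ((cmod (u m x - u n x))\<^sup>2) \<partial>M) \<le> ennreal e"
      using Cauchy by blast
    have "(\<integral>\<^sup>+x. ennreal ((cmod (u n x - lim (\<lambda>k. u (r k) x)))\<^sup>2) \<partial>M) \<le> ennreal e" if "n \<ge> K" for n
    proof -
      have "(\<integral>\<^sup>+x. ennreal ((cmod (u n x - lim (\<lambda>k. u (r k) x)))\<^sup>2) \<partial>M)
          = (\<integral>\<^sup>+x. liminf (\<lambda>k. ennreal ((cmod (u n x - u (r k) x))\<^sup>2)) \<partial>M)"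
      proof (rule nn_integral_cong_AE)
        show "AE x in M. ennreal ((cmod (u n x - lim (\<lambda>k. u (r k) x)))\<^sup>2)
            = liminf (\<lambda>k. ennreal ((cmod (u n x - u (r k) x))\<^sup>2))"
          using conv
        proof eventually_elim
          case (elim x)
          have "(\<lambda>k. ennreal ((cmod (u n x - u (r k) x))\<^sup>2))
              \<longlonglongrightarrow> ennreal ((cmod (u n x - lim (\<lambda>k. u (r k) x)))\<^sup>2)"
            by (intro tendsto_intros elim)
          then show ?case
            by (rule lim_imp_Liminf[OF sequentially_bot, symmetric])
        qed
      qed
      \<comment> \<open>Fatou's lemma, with \<open>n\<close> fixed and the index \<open>k\<close> of
        the subsequence tending to infinity.\<close>
      also have "\<dots> \<le> liminf (\<lambda>k. \<integral>\<^sup>+x. ennreal ((cmod (u n x - u (r k) x))\<^sup>2) \<partial>M)"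
        by (rule nn_integral_liminf) measurable
      also have "\<dots> \<le> ennreal e"
      proof -
        have "\<forall>\<^sub>F k in sequentially.
            (\<integral>\<^sup>+x. ennreal ((cmod (u n x - u (r k) x))\<^sup>2) \<partial>M) \<le> ennreal e"
          using eventually_ge_at_top[of K]
        proof eventually_elim
          case (elim k)
          then have "r k \<ge> K" using seq_suble[OF rmono, of k] by simp
          then show ?case using K that by simp
        qed
        then show ?thesis
          by (auto intro: Liminf_le)
      qed
      finally show ?thesis .
    qed
    then show "\<exists>N. \<forall>n\<ge>N.
        (\<integral>\<^sup>+x. ennreal ((cmod (u n x - lim (\<lambda>k. u (r k) x)))\<^sup>2) \<partial>M) \<le> ennreal e"
      by blast
  qed
qed

subsection \<open>Integration on the circle\<close>

text \<open>Restricting the space turns set integrals into ordinary ones, to which the general facts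
  on integrability and null sets apply directly. The total mass is \<open>2 * pi\<close>; the
  normalisation stays in \<open>circ_int\<close>.\<close>

definition circ_lebesgue :: "real measure" where
  "circ_lebesgue = restrict_space lborel {0..2*pi}"

definition meas_circ :: "(complex \<Rightarrow> complex) \<Rightarrow> bool" where
  "meas_circ f \<longleftrightarrow> (\<lambda>t. f (cis t)) \<in> borel_measurable circ_lebesgue"

definition L1_circ :: "(complex \<Rightarrow> complex) \<Rightarrow> bool" where
  "L1_circ f \<longleftrightarrow> integrable circ_lebesgue (\<lambda>t. f (cis t))"

lemma finite_measure_circ: "finite_measure circ_lebesgue"
  by (rule finite_measureI) (simp add: circ_lebesgue_def space_restrict_space emeasure_restrict_space)

lemma circ_int_eq: "circ_int f = (LINT t|circ_lebesgue. f (cis t)) / (2 * pi)"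
  by (simp add: circ_int_def circ_lebesgue_def set_lebesgue_integral_def integral_restrict_space)

lemma circ_ae_eq: "circ_ae P \<longleftrightarrow> (AE t in circ_lebesgue. P (cis t))"
  unfolding circ_ae_def circ_lebesgue_def by (subst AE_restrict_space_iff) auto

lemma L2_circ_eq: "L2_circ f \<longleftrightarrow> meas_circ f \<and> integrable circ_lebesgue (\<lambda>t. (cmod (f (cis t)))\<^sup>2)"
  by (simp add: L2_circ_def meas_circ_def circ_lebesgue_def set_integrable_def set_borel_measurable_def
      integrable_restrict_space borel_measurable_restrict_space_iff)

lemma normsq_circ_eq: "normsq_circ f = (LINT t|circ_lebesgue. (cmod (f (cis t)))\<^sup>2) / (2 * pi)"
  by (simp add: normsq_circ_def circ_lebesgue_def set_lebesgue_integral_def integral_restrict_space)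

lemma meas_circ_continuous:
  assumes "continuous_on (sphere 0 1) f"
  shows "meas_circ f"
proof -
  have "continuous_on UNIV (\<lambda>t. f (cis t))"
    by (rule continuous_on_compose2[OF assms]) (auto intro!: continuous_intros)
  then have "(\<lambda>t. f (cis t)) \<in> borel_measurable borel"
    by (rule borel_measurable_continuous_onI)
  then show ?thesis
    unfolding meas_circ_def circ_lebesgue_def by (intro measurable_restrict_space1) simp
qed

lemma L2_circ_meas [dest]: "L2_circ f \<Longrightarrow> meas_circ f"
  by (simp add: L2_circ_eq)

lemma meas_circ_mult: "meas_circ f \<Longrightarrow> meas_circ g \<Longrightarrow> meas_circ (\<lambda>z. f z * g z)"
  unfolding meas_circ_def by measurable

lemma meas_circ_add: "meas_circ f \<Longrightarrow> meas_circ g \<Longrightarrow> meas_circ (\<lambda>z. f z + g z)"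
  unfolding meas_circ_def by measurable

lemma meas_circ_cnj: "meas_circ f \<Longrightarrow> meas_circ (\<lambda>z. cnj (f z))"
  unfolding meas_circ_def by (rule borel_measurable_continuous_on[of cnj]) (auto intro: continuous_intros)

section \<open>Closure properties of square-integrable and integrable functions on the
  circle\<close>

lemma L2_circ_bounded_mult:
  assumes f: "L2_circ f" and g: "meas_circ g" and B: "circ_ae (\<lambda>z. cmod (g z) \<le> B)"
  shows "L2_circ (\<lambda>z. g z * f z)"
proof -
  have "integrable circ_lebesgue (\<lambda>t. (cmod (g (cis t) * f (cis t)))\<^sup>2)"
  proof (rule Bochner_Integration.integrable_bound)
    show "integrable circ_lebesgue (\<lambda>t. B\<^sup>2 * (cmod (f (cis t)))\<^sup>2)"
      using f by (simp add: L2_circ_eq)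
    show "(\<lambda>t. (cmod (g (cis t) * f (cis t)))\<^sup>2) \<in> borel_measurable circ_lebesgue"
      using f g by (auto simp: L2_circ_eq meas_circ_def)
    show "AE t in circ_lebesgue. norm ((cmod (g (cis t) * f (cis t)))\<^sup>2)
        \<le> norm (B\<^sup>2 * (cmod (f (cis t)))\<^sup>2)"
      using B unfolding circ_ae_eq
      by eventually_elim (auto simp: norm_mult power_mult_distrib intro!: mult_right_mono power_mono)
  qed
  then show ?thesis
    using f g by (simp add: L2_circ_eq meas_circ_mult)
qed

lemma L2_circ_bounded:
  assumes "meas_circ g" "circ_ae (\<lambda>z. cmod (g z) \<le> B)"
  shows "L2_circ g"
proof -
  interpret finite_measure circ_lebesgue by (rule finite_measure_circ)
  have "L2_circ (\<lambda>z. 1)"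
    by (simp add: L2_circ_eq meas_circ_def)
  from L2_circ_bounded_mult[OF this assms] show ?thesis by simp
qed

lemma continuous_circ_bounded:
  assumes "continuous_on (sphere 0 1) (f :: complex \<Rightarrow> complex)"
  shows "\<exists>B. \<forall>t. cmod (f (cis t)) \<le> B"
proof -
  have "bounded (f ` sphere 0 1)"
    using assms by (intro compact_imp_bounded compact_continuous_image) auto
  then obtain B where "\<And>y. y \<in> f ` sphere 0 1 \<Longrightarrow> norm y \<le> B"
    by (auto simp: bounded_iff)
  then have "cmod (f (cis t)) \<le> B" for t
    by auto
  then show ?thesis by blast
qed

lemma L2_circ_continuous_mult:
  assumes "L2_circ f" and g: "continuous_on (sphere 0 1) g"
  shows "L2_circ (\<lambda>z. g z * f z)"
proof -
  obtain B where "\<And>t. cmod (g (cis t)) \<le> B"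
    using continuous_circ_bounded[OF g] by blast
  then show ?thesis
    using assms meas_circ_continuous by (intro L2_circ_bounded_mult[of _ _ B]) (auto simp: circ_ae_eq)
qed

lemma L2_circ_continuous:
  assumes g: "continuous_on (sphere 0 1) g"
  shows "L2_circ g"
proof -
  obtain B where "\<And>t. cmod (g (cis t)) \<le> B"
    using continuous_circ_bounded[OF g] by blast
  then show ?thesis
    using assms meas_circ_continuous by (intro L2_circ_bounded[of _ B]) (auto simp: circ_ae_eq)
qed

lemma L2_circ_const [simp]: "L2_circ (\<lambda>z. c)"
  by (intro L2_circ_continuous continuous_intros)

lemma L2_circ_cmult: "L2_circ f \<Longrightarrow> L2_circ (\<lambda>z. c * f z)"
  by (intro L2_circ_continuous_mult continuous_intros)

lemma L2_circ_add:
  assumes f: "L2_circ f" and g: "L2_circ g"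
  shows "L2_circ (\<lambda>z. f z + g z)"
proof -
  have "integrable circ_lebesgue (\<lambda>t. (cmod (f (cis t) + g (cis t)))\<^sup>2)"
  proof (rule Bochner_Integration.integrable_bound)
    show "integrable circ_lebesgue (\<lambda>t. 2 * (cmod (f (cis t)))\<^sup>2 + 2 * (cmod (g (cis t)))\<^sup>2)"
      using f g by (simp add: L2_circ_eq)
    show "(\<lambda>t. (cmod (f (cis t) + g (cis t)))\<^sup>2) \<in> borel_measurable circ_lebesgue"
      using f g by (auto simp: L2_circ_eq meas_circ_def)
    have "(cmod (a + b))\<^sup>2 \<le> 2 * (cmod a)\<^sup>2 + 2 * (cmod b)\<^sup>2" for a b :: complex
    proof -
      have "(cmod (a + b))\<^sup>2 \<le> (cmod a + cmod b)\<^sup>2"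
        by (intro power_mono norm_triangle_ineq) auto
      also have "\<dots> \<le> 2 * (cmod a)\<^sup>2 + 2 * (cmod b)\<^sup>2"
        using zero_le_power2[of "cmod a - cmod b"] by (simp add: power2_sum power2_diff)
      finally show ?thesis .
    qed
    then show "AE t in circ_lebesgue. norm ((cmod (f (cis t) + g (cis t)))\<^sup>2)
        \<le> norm (2 * (cmod (f (cis t)))\<^sup>2 + 2 * (cmod (g (cis t)))\<^sup>2)"
      by (auto intro!: AE_I2)
  qed
  then show ?thesis
    using f g by (simp add: L2_circ_eq meas_circ_add)
qed

lemma L2_circ_diff: "L2_circ f \<Longrightarrow> L2_circ g \<Longrightarrow> L2_circ (\<lambda>z. f z - g z)"
  using L2_circ_add[of f "\<lambda>z. - 1 * g z"] L2_circ_cmult[of g "- 1"] by simp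

lemma L2_circ_cnj: "L2_circ f \<Longrightarrow> L2_circ (\<lambda>z. cnj (f z))"
  by (simp add: L2_circ_eq meas_circ_cnj)

lemma L2_circ_mult_L1:
  assumes f: "L2_circ f" and g: "L2_circ g"
  shows "L1_circ (\<lambda>z. f z * g z)"
  unfolding L1_circ_def
proof (rule Bochner_Integration.integrable_bound)
  show "integrable circ_lebesgue (\<lambda>t. (cmod (f (cis t)))\<^sup>2 + (cmod (g (cis t)))\<^sup>2)"
    using f g by (simp add: L2_circ_eq)
  show "(\<lambda>t. f (cis t) * g (cis t)) \<in> borel_measurable circ_lebesgue"
    using f g by (auto simp: L2_circ_eq meas_circ_def)
  have "cmod (a * b) \<le> (cmod a)\<^sup>2 + (cmod b)\<^sup>2" for a b :: complex
  proof -
    have "2 * (cmod a * cmod b) \<le> (cmod a)\<^sup>2 + (cmod b)\<^sup>2"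
      using zero_le_power2[of "cmod a - cmod b"] by (simp add: power2_diff)
    moreover have "0 \<le> cmod a * cmod b" by simp
    ultimately show ?thesis unfolding norm_mult by linarith
  qed
  then show "AE t in circ_lebesgue. norm (f (cis t) * g (cis t))
      \<le> norm ((cmod (f (cis t)))\<^sup>2 + (cmod (g (cis t)))\<^sup>2)"
    by (auto intro!: AE_I2)
qed

lemma L2_circ_L1: "L2_circ f \<Longrightarrow> L1_circ f"
  using L2_circ_mult_L1[of f "\<lambda>z. 1"] by simp

lemma L1_circ_cmult: "L1_circ f \<Longrightarrow> L1_circ (\<lambda>z. c * f z)"
  by (simp add: L1_circ_def)

lemma L1_circ_diff: "L1_circ f \<Longrightarrow> L1_circ g \<Longrightarrow> L1_circ (\<lambda>z. f z - g z)"
  by (simp add: L1_circ_def)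

lemma L1_circ_bounded_mult:
  assumes f: "L1_circ f" and g: "meas_circ g" and B: "\<And>t. cmod (g (cis t)) \<le> B"
  shows "L1_circ (\<lambda>z. g z * f z)"
  unfolding L1_circ_def
proof (rule Bochner_Integration.integrable_bound)
  show "integrable circ_lebesgue (\<lambda>t. of_real B * f (cis t))"
    using f by (simp add: L1_circ_def)
  have "meas_circ f"
    using f by (auto simp: L1_circ_def meas_circ_def)
  then show "(\<lambda>t. g (cis t) * f (cis t)) \<in> borel_measurable circ_lebesgue"
    using meas_circ_mult[OF g] by (simp add: meas_circ_def)
  have "cmod (g (cis t)) \<le> \<bar>B\<bar>" for t
    using B[of t] by linarith
  then show "AE t in circ_lebesgue. norm (g (cis t) * f (cis t)) \<le> norm (of_real B * f (cis t))"
    by (auto intro!: AE_I2 mult_right_mono simp: norm_mult)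
qed

lemma L1_circ_continuous_mult:
  assumes "L1_circ f" and g: "continuous_on (sphere 0 1) g"
  shows "L1_circ (\<lambda>z. g z * f z)"
proof -
  obtain B where "\<And>t. cmod (g (cis t)) \<le> B"
    using continuous_circ_bounded[OF g] by blast
  then show ?thesis
    using assms meas_circ_continuous by (intro L1_circ_bounded_mult[of _ _ B])
qed

section \<open>Rules for the circle integral and integrals of monomials\<close>

lemma circ_int_add: "L1_circ f \<Longrightarrow> L1_circ g \<Longrightarrow> circ_int (\<lambda>z. f z + g z) = circ_int f + circ_int g"
  by (simp add: L1_circ_def circ_int_eq add_divide_distrib)

lemma circ_int_diff: "L1_circ f \<Longrightarrow> L1_circ g \<Longrightarrow> circ_int (\<lambda>z. f z - g z) = circ_int f - circ_int g"
  by (simp add: L1_circ_def circ_int_eq diff_divide_distrib)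

lemma circ_int_cmult [simp]: "circ_int (\<lambda>z. c * f z) = c * circ_int f"
  by (simp add: circ_int_eq)

lemma circ_int_sum: "(\<And>i. i \<in> I \<Longrightarrow> L1_circ (f i)) \<Longrightarrow>
    circ_int (\<lambda>z. \<Sum>i\<in>I. f i z) = (\<Sum>i\<in>I. circ_int (f i))"
  by (simp add: L1_circ_def circ_int_eq sum_divide_distrib)

lemma circ_int_cnj: "circ_int (\<lambda>z. cnj (f z)) = cnj (circ_int f)"
  by (simp add: circ_int_eq)

lemma circ_int_cong: "(\<And>z. cmod z = 1 \<Longrightarrow> f z = g z) \<Longrightarrow> circ_int f = circ_int g"
  by (simp add: circ_int_eq)

lemma circ_int_cong_ae:
  assumes "meas_circ f" "meas_circ g" "circ_ae (\<lambda>z. f z = g z)"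
  shows "circ_int f = circ_int g"
  using assms unfolding circ_int_eq meas_circ_def circ_ae_eq by (subst integral_cong_AE) auto

lemma circ_ae_conj: "circ_ae P \<Longrightarrow> circ_ae Q \<Longrightarrow> circ_ae (\<lambda>z. P z \<and> Q z)"
  unfolding circ_ae_eq by (rule AE_conjI)

lemma circ_ae_mono: "circ_ae P \<Longrightarrow> (\<And>z. P z \<Longrightarrow> Q z) \<Longrightarrow> circ_ae Q"
  unfolding circ_ae_eq by (erule eventually_mono) auto

lemma continuous_powi_circ: "continuous_on (sphere 0 1) (\<lambda>z::complex. z powi n)"
  by (intro continuous_intros) auto

lemma powi_circ_cnj: "cmod z = 1 \<Longrightarrow> cnj (z powi n) = z powi (- n)"
proof -
  assume "cmod z = 1"
  then have "cnj z = inverse z"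
    by (metis complex_cnj_cnj complex_norm_square inverse_unique mult.commute norm_one of_real_1 power_one)
  then show ?thesis
    by (simp add: power_int_inverse power_int_minus)
qed

lemma circ_int_powi: "circ_int (\<lambda>z. z powi k) = (if k = 0 then 1 else 0)"
proof (cases "k = 0")
  case True
  then show ?thesis by (simp add: circ_int_def set_lebesgue_integral_def scaleR_conv_of_real)
next
  case False
  have "(LINT t|lborel. indicator {0..2*pi} t *\<^sub>R cis (of_int k * t)) =
      cis (of_int k * (2 * pi)) / (\<i> * of_int k) - cis (of_int k * 0) / (\<i> * of_int k)"
  proof (rule integral_FTC_Icc)
    show "((\<lambda>t. cis (of_int k * t) / (\<i> * of_int k)) has_vector_derivative cis (of_int k * t)) (at t within {0..2*pi})" for t
    proof -
      have "((\<lambda>z. exp (\<i> * of_int k * z) / (\<i> * of_int k)) has_field_derivative exp (\<i> * of_int k * of_real t))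
          (at (of_real t))"
        using False by (auto intro!: derivative_eq_intros)
      from has_vector_derivative_real_field[OF this] show ?thesis
        by (simp add: cis_conv_exp mult_ac)
    qed
  qed (auto intro!: continuous_intros)
  also have "cis (of_int k * (2 * pi)) = 1"
    by (metis cis_multiple_2pi Ints_of_int mult.commute)
  finally show ?thesis
    using False by (simp add: circ_int_def set_lebesgue_integral_def cis_power_int)
qed

subsection \<open>Uniqueness of Fourier coefficients\<close>

lemma fourier_coeff_L1: "L1_circ f \<Longrightarrow> L1_circ (\<lambda>z. f z * z powi n)"
  using L1_circ_continuous_mult[OF _ continuous_powi_circ] by (simp add: mult.commute)

lemma fourier_coeff_add: "L1_circ f \<Longrightarrow> L1_circ g \<Longrightarrow>
    fourier_coeff (\<lambda>z. f z + g z) n = fourier_coeff f n + fourier_coeff g n"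
  unfolding fourier_coeff_def by (simp add: distrib_right circ_int_add fourier_coeff_L1)

lemma fourier_coeff_diff: "L1_circ f \<Longrightarrow> L1_circ g \<Longrightarrow>
    fourier_coeff (\<lambda>z. f z - g z) n = fourier_coeff f n - fourier_coeff g n"
  unfolding fourier_coeff_def by (simp add: left_diff_distrib circ_int_diff fourier_coeff_L1)

lemma fourier_coeff_cmult: "fourier_coeff (\<lambda>z. c * f z) n = c * fourier_coeff f n"
  unfolding fourier_coeff_def by (simp add: mult.assoc)

lemma fourier_coeff_cnj: "fourier_coeff (\<lambda>z. cnj (f z)) n = cnj (fourier_coeff f (- n))"
  unfolding fourier_coeff_def circ_int_cnj[symmetric]
  by (intro circ_int_cong) (simp add: powi_circ_cnj del: complex_cnj_power_int)

lemma fourier_coeff_shift: "fourier_coeff (\<lambda>z. z powi k * f z) n = fourier_coeff f (n - k)"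
  unfolding fourier_coeff_def
proof (intro circ_int_cong)
  fix z :: complex assume "cmod z = 1"
  then have "z \<noteq> 0" by auto
  then have "z powi k * z powi (- n) = z powi (- (n - k))"
    by (subst power_int_add[symmetric]) auto
  then show "z powi k * f z * z powi (- n) = f z * z powi (- (n - k))"
    by (simp add: mult_ac)
qed

lemma fourier_coeff_powi: "fourier_coeff (\<lambda>z. z powi k) n = (if n = k then 1 else 0)"
  using fourier_coeff_shift[of k "\<lambda>z. 1" n] circ_int_powi[of "- (n - k)"]
  by (simp add: fourier_coeff_def)

lemma fourier_coeff_const: "fourier_coeff (\<lambda>z. c) n = (if n = 0 then c else 0)"
  using fourier_coeff_cmult[of c "\<lambda>z. 1" n] by (cases "n = 0"; simp add: fourier_coeff_powi[of 0, simplified])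

lemma fourier_coeff_cong_ae:
  assumes "meas_circ f" "meas_circ g" "circ_ae (\<lambda>z. f z = g z)"
  shows "fourier_coeff f n = fourier_coeff g n"
  unfolding fourier_coeff_def
  using assms meas_circ_continuous[OF continuous_powi_circ[of "-n"]]
  by (intro circ_int_cong_ae meas_circ_mult) (auto elim: circ_ae_mono)

lemma norm_circ_int_le:
  assumes "L1_circ f" and "\<And>z. cmod z = 1 \<Longrightarrow> cmod (g z) \<le> e"
    and "meas_circ g"
  shows "cmod (circ_int (\<lambda>z. g z * f z)) \<le> e * (LINT t|circ_lebesgue. cmod (f (cis t)))"
proof -
  have "cmod (circ_int (\<lambda>z. g z * f z)) = cmod (LINT t|circ_lebesgue. g (cis t) * f (cis t)) / (2*pi)"
    unfolding circ_int_eq norm_divide by simp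
  \<comment> \<open>The normalising factor \<open>1 / (2 * pi)\<close> is simply estimated by
    1.\<close>
  also have "\<dots> \<le> cmod (LINT t|circ_lebesgue. g (cis t) * f (cis t)) / 1"
    by (rule divide_left_mono) (use pi_ge_two in auto)
  also have "\<dots> = cmod (LINT t|circ_lebesgue. g (cis t) * f (cis t))"
    by simp
  also have "\<dots> \<le> (LINT t|circ_lebesgue. cmod (g (cis t) * f (cis t)))"
    by (rule integral_norm_bound)
  also have "\<dots> \<le> (LINT t|circ_lebesgue. e * cmod (f (cis t)))"
  proof (rule integral_mono)
    have "L1_circ (\<lambda>z. g z * f z)"
      using assms by (intro L1_circ_bounded_mult[of _ _ e]) auto
    then show "integrable circ_lebesgue (\<lambda>t. cmod (g (cis t) * f (cis t)))"
      by (simp add: L1_circ_def)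
    show "integrable circ_lebesgue (\<lambda>t. e * cmod (f (cis t)))"
      using assms by (simp add: L1_circ_def)
  qed (auto simp: norm_mult intro!: mult_right_mono assms)
  finally show ?thesis by simp
qed

text \<open>On the circle a real linear form is a combination of \<open>z\<close> and its inverse,
  and multiplication by these only shifts coefficients. The product case applies the hypothesis for
  \<open>p\<close> to \<open>q\<close> times \<open>f\<close>, hence the generalisation over
  \<open>f\<close>.\<close>

lemma fourier_coeff_zero_polynomial_mult:
  fixes p :: "complex \<Rightarrow> real"
  assumes "real_polynomial_function p" and "L1_circ f" and "\<And>n. fourier_coeff f n = 0"
  shows "fourier_coeff (\<lambda>z. of_real (p z) * f z) n = 0"
  using assms
proof (induction p arbitrary: f n rule: real_polynomial_function.induct)
  case (linear p)
  note hyps = linear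
  interpret bounded_linear p by (rule hyps)
  \<comment> \<open>Since \<open>Re z = (z + 1/z) / 2\<close> and
    \<open>Im z = (z - 1/z) / (2 * \<i>)\<close> on the circle, these are the coefficients of
    \<open>z\<close> and \<open>1/z\<close> in \<open>Re z * p 1 + Im z * p \<i>\<close>.\<close>
  define a b where "a = (of_real (p 1) - \<i> * of_real (p \<i>)) / 2"
    and "b = (of_real (p 1) + \<i> * of_real (p \<i>)) / (2::complex)"
  have p: "of_real (p z) = a * z powi 1 + b * z powi (-1)" if "cmod z = 1" for z
  proof -
    have "p z = p (Re z *\<^sub>R 1 + Im z *\<^sub>R \<i>)"
      by (rule arg_cong[of _ _ p]) (simp add: complex_eq_iff)
    also have "\<dots> = Re z * p 1 + Im z * p \<i>"
      unfolding add scaleR by simp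
    finally have pz: "p z = Re z * p 1 + Im z * p \<i>" .
    have "z powi (-1) = cnj z"
      using powi_circ_cnj[OF that, of 1] by simp
    then have "a * z powi 1 + b * z powi (-1) = a * z + b * cnj z"
      by simp
    also have "\<dots> = of_real (p z)"
      unfolding pz a_def b_def by (simp add: complex_eq_iff field_simps)
    finally show ?thesis by simp
  qed
  have "fourier_coeff (\<lambda>z. of_real (p z) * f z) n =
      fourier_coeff (\<lambda>z. a * (z powi 1 * f z) + b * (z powi (-1) * f z)) n"
    unfolding fourier_coeff_def by (intro circ_int_cong) (auto simp: p distrib_right)
  also have "\<dots> = 0"
    using hyps
    by (subst fourier_coeff_add)
      (auto simp: fourier_coeff_cmult fourier_coeff_shift simp del: power_int_1_right power_int_minus_left power_int_minus1_right
        intro!: L1_circ_cmult L1_circ_continuous_mult continuous_powi_circ)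
  finally show ?case .
next
  case (const c)
  then show ?case by (simp add: fourier_coeff_cmult)
next
  case (add p q)
  have "L1_circ (\<lambda>z. of_real (r z) * f z)" if "real_polynomial_function r" for r
    using add that by (intro L1_circ_continuous_mult continuous_on_of_real)
      (auto simp: real_polynomial_function_eq continuous_on_polymonial_function)
  then show ?case
    using add by (simp add: distrib_right fourier_coeff_add)
next
  case (mult p q)
  have "L1_circ (\<lambda>z. of_real (q z) * f z)"
    using mult by (intro L1_circ_continuous_mult continuous_on_of_real)
      (auto simp: real_polynomial_function_eq continuous_on_polymonial_function)
  then show ?case
    using mult by (simp add: mult.assoc)
qed

text \<open>Stone-Weierstrass approximates \<open>g\<close> uniformly by polynomials, whose
  integrals against \<open>f\<close> vanish; the error is at most the uniform distance times the
  integral of \<open>cmod f\<close>.\<close>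

lemma circ_int_zero_continuous_mult:
  fixes g :: "complex \<Rightarrow> real"
  assumes f: "L1_circ f" and zero: "\<And>n. fourier_coeff f n = 0" and g: "continuous_on (sphere 0 1) g"
  shows "circ_int (\<lambda>z. of_real (g z) * f z) = 0"
proof -
  define I where "I = (LINT t|circ_lebesgue. cmod (f (cis t)))"
  have "I \<ge> 0"
    unfolding I_def by (intro Bochner_Integration.integral_nonneg) auto
  have "cmod (circ_int (\<lambda>z. of_real (g z) * f z)) \<le> 0 + e" if "e > 0" for e
  proof -
    \<comment> \<open>Dividing by \<open>I + 1\<close> instead of \<open>I\<close> covers the case
      \<open>I = 0\<close>.\<close>
    have "e / (I + 1) > 0"
      using that \<open>I \<ge> 0\<close> by simp
    then obtain p where p: "real_polynomial_function p"
      and le: "\<And>x. x \<in> sphere 0 1 \<Longrightarrow> \<bar>g x - p x\<bar> < e / (I + 1)"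
      using Stone_Weierstrass_real_polynomial_function[OF _ g] by (metis compact_sphere)
    have cp: "continuous_on (sphere 0 1) p"
      using p by (simp add: real_polynomial_function_eq continuous_on_polymonial_function)
    have "circ_int (\<lambda>z. of_real (p z) * f z) = 0"
      using fourier_coeff_zero_polynomial_mult[OF p f zero, of 0] by (simp add: fourier_coeff_def)
    moreover have "L1_circ (\<lambda>z. of_real (g z) * f z)" "L1_circ (\<lambda>z. of_real (p z) * f z)"
      using f g cp by (auto intro!: L1_circ_continuous_mult continuous_on_of_real)
    ultimately have "circ_int (\<lambda>z. of_real (g z) * f z) = circ_int (\<lambda>z. of_real (g z - p z) * f z)"
      by (simp add: circ_int_diff left_diff_distrib)
    also have "cmod \<dots> \<le> e / (I + 1) * I"
      unfolding I_def
    proof (rule norm_circ_int_le[OF f])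
      fix z :: complex assume "cmod z = 1"
      then have "\<bar>g z - p z\<bar> < e / (I + 1)" by (intro le) auto
      then show "cmod (of_real (g z - p z)) \<le> e / ((LINT t|circ_lebesgue. cmod (f (cis t))) + 1)"
        unfolding I_def[symmetric] norm_of_real by simp
    qed (auto intro!: meas_circ_continuous continuous_intros g cp)
    also have "\<dots> \<le> e"
      using that \<open>I \<ge> 0\<close> by (simp add: field_simps)
    finally show ?thesis by simp
  qed
  then have "cmod (circ_int (\<lambda>z. of_real (g z) * f z)) \<le> 0"
    by (rule field_le_epsilon)
  then show ?thesis by simp
qed

text \<open>The indicator of a nonempty closed set is the limit of the continuous functions
  \<open>max 0 (1 - n * infdist z A)\<close>, and \<open>cmod f\<close> dominates the products. The
  empty set is split off because \<open>infdist\<close> to it is 0 by convention.\<close>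

lemma circ_int_zero_closed:
  assumes f: "L1_circ f" and zero: "\<And>n. fourier_coeff f n = 0" and A: "closed A"
  shows "circ_int (\<lambda>z. indicator A z * f z) = 0"
proof (cases "A = {}")
  case True
  then show ?thesis by (simp add: circ_int_eq)
next
  case False
  define g where "g n z = max 0 (1 - real n * infdist z A)" for n and z :: complex
  have cg: "continuous_on (sphere 0 1) (g n)" for n
    unfolding g_def by (intro continuous_intros)
  have lim: "(\<lambda>n. g n z) \<longlonglongrightarrow> indicator A z" for z
  proof (cases "z \<in> A")
    case True
    then show ?thesis by (simp add: g_def)
  next
    case zA: False
    then have pos: "infdist z A > 0"
      using infdist_pos_not_in_closed[OF A False] by simp
    obtain N where N: "real N * infdist z A > 1"
      using reals_Archimedean3[OF pos] by blast
    have "\<forall>\<^sub>F n in sequentially. g n z = 0"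
      using eventually_ge_at_top[of N]
    proof eventually_elim
      case (elim n)
      then have "real N * infdist z A \<le> real n * infdist z A"
        by (intro mult_right_mono) (auto simp: infdist_nonneg)
      with N show ?case by (simp add: g_def)
    qed
    then show ?thesis
      using zA by (simp add: tendsto_eventually)
  qed
  have "(\<lambda>n. LINT t|circ_lebesgue. of_real (g n (cis t)) * f (cis t)) \<longlonglongrightarrow>
      (LINT t|circ_lebesgue. of_real (indicator A (cis t)) * f (cis t))"
  proof (rule integral_dominated_convergence[where w = "\<lambda>t. cmod (f (cis t))"])
    have m: "meas_circ (\<lambda>z. of_real (g n z) * f z)" for n
      using L1_circ_continuous_mult[OF f continuous_on_of_real[OF cg]]
      by (auto simp: L1_circ_def meas_circ_def)
    then show "(\<lambda>t. of_real (g n (cis t)) * f (cis t)) \<in> borel_measurable circ_lebesgue" for n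
      by (simp add: meas_circ_def)
    have l: "(\<lambda>n. of_real (g n z) * f z) \<longlonglongrightarrow> of_real (indicator A z) * f z" for z
      by (intro tendsto_intros lim)
    show "(\<lambda>t. of_real (indicator A (cis t)) * f (cis t)) \<in> borel_measurable circ_lebesgue"
      using m unfolding meas_circ_def by (rule borel_measurable_LIMSEQ_metric) (rule l)
    show "integrable circ_lebesgue (\<lambda>t. cmod (f (cis t)))"
      using f by (simp add: L1_circ_def)
    show "AE t in circ_lebesgue. (\<lambda>n. of_real (g n (cis t)) * f (cis t)) \<longlonglongrightarrow> of_real (indicator A (cis t)) * f (cis t)"
      by (intro AE_I2 l)
    have "\<bar>g n z\<bar> \<le> 1" for n z
      by (auto simp: g_def infdist_nonneg)
    then show "AE t in circ_lebesgue. norm (of_real (g n (cis t)) * f (cis t)) \<le> cmod (f (cis t))" for n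
      by (auto intro!: AE_I2 mult_left_le_one_le simp: norm_mult)
  qed
  moreover have "(LINT t|circ_lebesgue. of_real (g n (cis t)) * f (cis t)) = 0" for n
    using circ_int_zero_continuous_mult[OF f zero cg, of n] by (simp add: circ_int_eq)
  moreover have "of_real (indicator A z) = (indicator A z :: complex)" for z
    by (simp add: indicator_def)
  ultimately show ?thesis
    by (simp add: circ_int_eq LIMSEQ_const_iff)
qed

lemma cis_eq_imp_eq:
  assumes "cis t = cis s" "\<bar>t - s\<bar> < 2 * pi"
  shows "t = s"
proof -
  have "cis (t - s) = 1"
    using assms(1) cis_divide[of t s] by simp
  then have "cos (t - s) = 1"
    by (metis cis.sel(1) one_complex.sel(1))
  then obtain n :: int where n: "t - s = of_int n * 2 * pi"
    by (auto simp: cos_one_2pi_int)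
  with assms(2) have "\<bar>of_int n :: real\<bar> * (2 * pi) < 1 * (2 * pi)"
    by (simp add: abs_mult)
  then have "n = 0"
    by (simp add: mult_less_cancel_right)
  with n show ?thesis by simp
qed

text \<open>An integrable function with vanishing integral over every measurable set is zero almost
  everywhere. Sets of parameters are handled by Borel induction, starting from intervals, whose
  traces on \<open>{0..2*pi}\<close> have closed images under \<open>cis\<close>.\<close>

lemma fourier_coeff_unique_zero:
  assumes f: "L1_circ f" and zero: "\<And>n. fourier_coeff f n = 0"
  shows "circ_ae (\<lambda>z. f z = 0)"
proof -
  interpret finite_measure circ_lebesgue by (rule finite_measure_circ)
  let ?F = "\<lambda>t. f (cis t)"
  have F: "integrable circ_lebesgue ?F"
    using f by (simp add: L1_circ_def)
  have sp: "space circ_lebesgue = {0..2*pi}"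
    by (simp add: circ_lebesgue_def space_restrict_space)
  have sets: "sets circ_lebesgue = (\<lambda>X. {0..2*pi} \<inter> X) ` sets borel"
    by (simp add: circ_lebesgue_def sets_restrict_space)
  have si: "set_integrable circ_lebesgue ({0..2*pi} \<inter> X) ?F" if "X \<in> sets borel" for X
    using F that unfolding set_integrable_def by (intro integrable_mult_indicator) (auto simp: sets)
  \<comment> \<open>The integral over the whole circle is the coefficient at 0 up to normalisation;
    the complement case of the induction subtracts from it.\<close>
  have full: "(LINT t:{0..2*pi}|circ_lebesgue. ?F t) = 0"
  proof -
    have "circ_int f = 0"
      using zero[of 0] by (simp add: fourier_coeff_def)
    then show ?thesis
      unfolding sp[symmetric] by (simp add: circ_int_eq set_lebesgue_integral_def indicator_def cong: Bochner_Integration.integral_cong)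
  qed
  have main: "(LINT t:({0..2*pi} \<inter> X)|circ_lebesgue. ?F t) = 0" if "X \<in> sets borel" for X
    using that
  proof (induction X rule: borel_set_induct)
    case empty
    show ?case by (simp add: set_lebesgue_integral_def)
  next
    case (interval a b)
    let ?K = "{0..2*pi} \<inter> {a..b}"
    have "compact ?K"
      by (simp add: compact_Int)
    then have "closed (cis ` ?K)"
      by (intro compact_imp_closed compact_continuous_image continuous_intros)
    from circ_int_zero_closed[OF f zero this]
    have "(LINT t|circ_lebesgue. indicator (cis ` ?K) (cis t) * ?F t) = 0"
      by (simp add: circ_int_eq)
    also have "(LINT t|circ_lebesgue. indicator (cis ` ?K) (cis t) * ?F t) = (LINT t:?K|circ_lebesgue. ?F t)"
      unfolding set_lebesgue_integral_def
    proof (rule integral_cong_AE)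
      have ms: "(\<lambda>t. indicator (cis ` ?K) (cis t) :: complex) \<in> borel_measurable circ_lebesgue"
      proof -
        have "closed (cis -` (cis ` ?K))"
          using \<open>closed (cis ` ?K)\<close> by (intro closed_vimage continuous_intros)
        then have "(indicator (cis -` (cis ` ?K)) :: real \<Rightarrow> complex) \<in> borel_measurable borel"
          by (intro borel_measurable_indicator borel_closed)
        moreover have "(\<lambda>t. indicator (cis ` ?K) (cis t) :: complex) = indicator (cis -` (cis ` ?K))"
          by (auto simp: indicator_def)
        ultimately show ?thesis
          unfolding circ_lebesgue_def by (intro measurable_restrict_space1) simp
      qed
      then show "(\<lambda>t. indicator (cis ` ?K) (cis t) * ?F t) \<in> borel_measurable circ_lebesgue"
        using F by (intro borel_measurable_times) auto
      show "(\<lambda>t. indicator ?K t *\<^sub>R ?F t) \<in> borel_measurable circ_lebesgue"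
        using si[of "{a..b}"] by (auto simp: set_integrable_def)
      \<comment> \<open>\<open>cis\<close> identifies the endpoints \<open>0\<close> and
        \<open>2 * pi\<close>, which form a null set; for every other parameter,
        \<open>cis t\<close> lies in the image of \<open>?K\<close> exactly if \<open>t\<close> lies
        in \<open>?K\<close>.\<close>
      have "AE t in lborel. t \<noteq> 0 \<and> t \<noteq> 2 * pi"
        using AE_lborel_singleton[of 0] AE_lborel_singleton[of "2*pi"] by eventually_elim simp
      then have "AE t in circ_lebesgue. 0 < t \<and> t < 2 * pi"
        unfolding circ_lebesgue_def by (subst AE_restrict_space_iff) auto
      then show "AE t in circ_lebesgue. indicator (cis ` ?K) (cis t) * ?F t = indicator ?K t *\<^sub>R ?F t"
      proof eventually_elim
        case (elim t)
        have "t = s" if "cis t = cis s" "0 \<le> s" "s \<le> 2*pi" for s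
          using elim that by (intro cis_eq_imp_eq) auto
        then have "cis t \<in> cis ` ?K \<longleftrightarrow> t \<in> ?K" by auto
        then show ?case by (simp add: indicator_def)
      qed
    qed
    finally show ?case .
  next
    case (compl A)
    have "(LINT t:(({0..2*pi} \<inter> A) \<union> ({0..2*pi} \<inter> - A))|circ_lebesgue. ?F t) =
        (LINT t:({0..2*pi} \<inter> A)|circ_lebesgue. ?F t) + (LINT t:({0..2*pi} \<inter> - A)|circ_lebesgue. ?F t)"
      using compl by (intro set_integral_Un si) auto
    moreover have "({0..2*pi} \<inter> A) \<union> ({0..2*pi} \<inter> - A) = {0..2*pi}" by blast
    ultimately show ?case using compl full by simp
  next
    case (union A)
    have eq: "{0..2*pi} \<inter> (\<Union>i. A i) = (\<Union>i. {0..2*pi} \<inter> A i)"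
      by blast
    have U: "(\<Union>i. A i) \<in> sets borel"
      using union.hyps(2) by blast
    have "(LINT t:(\<Union>i. {0..2*pi} \<inter> A i)|circ_lebesgue. ?F t) =
        (\<Sum>i. LINT t:({0..2*pi} \<inter> A i)|circ_lebesgue. ?F t)"
    proof (rule lebesgue_integral_countable_add)
      show "set_integrable circ_lebesgue (\<Union>i. {0..2*pi} \<inter> A i) ?F"
        using si[OF U] unfolding eq .
      show "{0..2*pi} \<inter> A i \<in> sets circ_lebesgue" for i
        unfolding sets using union.hyps(2) by (rule imageI)
      show "{0..2*pi} \<inter> A i \<inter> ({0..2*pi} \<inter> A j) = {}" if "i \<noteq> j" for i j
        using union.hyps(1) that unfolding disjoint_family_on_def by blast
    qed
    also have "\<dots> = 0"
      by (simp only: union.IH suminf_zero)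
    finally show ?case unfolding eq .
  qed
  have "AE t in circ_lebesgue. ?F t = 0"
  proof (rule density_unique_banach[OF F])
    fix A assume "A \<in> sets circ_lebesgue"
    then obtain X where "X \<in> sets borel" "A = {0..2*pi} \<inter> X"
      unfolding sets by blast
    then show "(LINT t:A|circ_lebesgue. ?F t) = (LINT t:A|circ_lebesgue. 0)"
      using main by (simp add: set_lebesgue_integral_def)
  qed simp
  then show ?thesis
    by (simp add: circ_ae_eq)
qed

subsection \<open>Fourier series of square-integrable functions\<close>

lemma normsq_circ_nonneg: "normsq_circ f \<ge> 0"
  unfolding normsq_circ_eq by (intro divide_nonneg_nonneg Bochner_Integration.integral_nonneg) auto

lemma circ_int_mult_cnj: "circ_int (\<lambda>z. f z * cnj (f z)) = of_real (normsq_circ f)"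
  unfolding circ_int_eq normsq_circ_eq complex_norm_square[symmetric] by (simp del: of_real_power)

lemma normsq_circ_cong_ae:
  assumes "meas_circ f" "meas_circ g" "circ_ae (\<lambda>z. f z = g z)"
  shows "normsq_circ f = normsq_circ g"
proof -
  have "(LINT t|circ_lebesgue. (cmod (f (cis t)))\<^sup>2) = (LINT t|circ_lebesgue. (cmod (g (cis t)))\<^sup>2)"
    using assms unfolding meas_circ_def circ_ae_eq
    by (intro integral_cong_AE borel_measurable_power borel_measurable_norm) auto
  then show ?thesis by (simp add: normsq_circ_eq)
qed

lemma normsq_circ_eq_0:
  assumes "L2_circ f" "normsq_circ f = 0"
  shows "circ_ae (\<lambda>z. f z = 0)"
proof -
  have "AE t in circ_lebesgue. (cmod (f (cis t)))\<^sup>2 = 0"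
    using assms by (subst integral_nonneg_eq_0_iff_AE[symmetric]) (auto simp: normsq_circ_eq L2_circ_eq)
  then show ?thesis by (simp add: circ_ae_eq)
qed

lemma nn_integral_circ:
  assumes "L2_circ f"
  shows "(\<integral>\<^sup>+t. ennreal ((cmod (f (cis t)))\<^sup>2) \<partial>circ_lebesgue) = ennreal (2 * pi * normsq_circ f)"
  using assms by (subst nn_integral_eq_integral) (auto simp: L2_circ_eq normsq_circ_eq)

text \<open>A weighted inequality of arithmetic and geometric means takes the place of
  Cauchy-Schwarz: \<open>e\<close> is first chosen to make the second term small, and the first term
  then tends to zero with the norm of \<open>f\<close>.\<close>

lemma cmod_circ_int_mult_le:
  assumes f: "L2_circ f" and g: "L2_circ g" and e: "e > 0"
  shows "cmod (circ_int (\<lambda>z. f z * g z)) \<le> normsq_circ f / e + e * normsq_circ g"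
proof -
  have le: "cmod (a * b) \<le> (cmod a)\<^sup>2 / e + e * (cmod b)\<^sup>2" for a b :: complex
  proof -
    have "0 \<le> (cmod a - e * cmod b)\<^sup>2" by simp
    then have "2 * e * (cmod a * cmod b) \<le> (cmod a)\<^sup>2 + e\<^sup>2 * (cmod b)\<^sup>2"
      by (simp add: power2_diff power_mult_distrib algebra_simps)
    moreover have "0 \<le> e * (cmod a * cmod b)" using e by simp
    ultimately have "e * (cmod a * cmod b) \<le> (cmod a)\<^sup>2 + e\<^sup>2 * (cmod b)\<^sup>2" by linarith
    then show ?thesis
      using e by (simp add: norm_mult field_simps power2_eq_square)
  qed
  have "cmod (circ_int (\<lambda>z. f z * g z)) = cmod (LINT t|circ_lebesgue. f (cis t) * g (cis t)) / (2*pi)"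
    unfolding circ_int_eq norm_divide by simp
  also have "\<dots> \<le> (LINT t|circ_lebesgue. (cmod (f (cis t)))\<^sup>2 / e + e * (cmod (g (cis t)))\<^sup>2) / (2*pi)"
  proof (rule divide_right_mono)
    have "cmod (LINT t|circ_lebesgue. f (cis t) * g (cis t)) \<le> (LINT t|circ_lebesgue. cmod (f (cis t) * g (cis t)))"
      by (rule integral_norm_bound)
    also have "\<dots> \<le> (LINT t|circ_lebesgue. (cmod (f (cis t)))\<^sup>2 / e + e * (cmod (g (cis t)))\<^sup>2)"
      using L2_circ_mult_L1[OF f g] f g by (intro integral_mono le) (auto simp: L1_circ_def L2_circ_eq)
    finally show "cmod (LINT t|circ_lebesgue. f (cis t) * g (cis t))
      \<le> (LINT t|circ_lebesgue. (cmod (f (cis t)))\<^sup>2 / e + e * (cmod (g (cis t)))\<^sup>2)" .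
  qed simp
  also have "\<dots> = normsq_circ f / e + e * normsq_circ g"
    using f g by (simp add: L2_circ_eq normsq_circ_eq add_divide_distrib)
  finally show ?thesis .
qed

section \<open>Trigonometric polynomials and Bessel's inequality\<close>

definition trig_poly :: "int set \<Rightarrow> (int \<Rightarrow> complex) \<Rightarrow> complex \<Rightarrow> complex" where
  "trig_poly A c z = (\<Sum>n\<in>A. c n * z powi n)"

lemma continuous_trig_poly: "continuous_on (sphere 0 1) (trig_poly A c)"
  unfolding trig_poly_def by (intro continuous_intros) auto

lemma L2_trig_poly: "L2_circ (trig_poly A c)"
  by (intro L2_circ_continuous continuous_trig_poly)

lemma circ_int_mult_trig_poly:
  assumes "L1_circ g"
  shows "circ_int (\<lambda>z. g z * trig_poly A c z) = (\<Sum>n\<in>A. c n * fourier_coeff g (- n))"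
proof -
  have "circ_int (\<lambda>z. g z * trig_poly A c z) = circ_int (\<lambda>z. \<Sum>n\<in>A. c n * (g z * z powi n))"
    by (intro circ_int_cong) (simp add: trig_poly_def sum_distrib_left mult_ac)
  also have "\<dots> = (\<Sum>n\<in>A. c n * fourier_coeff g (- n))"
    using assms by (subst circ_int_sum) (auto simp: fourier_coeff_def intro!: L1_circ_cmult fourier_coeff_L1)
  finally show ?thesis .
qed

lemma circ_int_mult_cnj_trig_poly:
  assumes "L1_circ g"
  shows "circ_int (\<lambda>z. g z * cnj (trig_poly A c z)) = (\<Sum>n\<in>A. fourier_coeff g n * cnj (c n))"
proof -
  have "circ_int (\<lambda>z. g z * cnj (trig_poly A c z)) = circ_int (\<lambda>z. \<Sum>n\<in>A. cnj (c n) * (g z * z powi (-n)))"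
    by (intro circ_int_cong)
      (simp add: trig_poly_def sum_distrib_left mult_ac powi_circ_cnj del: complex_cnj_power_int)
  also have "\<dots> = (\<Sum>n\<in>A. fourier_coeff g n * cnj (c n))"
    using assms by (subst circ_int_sum) (auto simp: fourier_coeff_def mult.commute intro!: L1_circ_cmult fourier_coeff_L1)
  finally show ?thesis .
qed

lemma fourier_coeff_trig_poly:
  assumes "finite A"
  shows "fourier_coeff (trig_poly A c) n = (if n \<in> A then c n else 0)"
proof -
  have "fourier_coeff (trig_poly A c) n = circ_int (\<lambda>z. z powi (- n) * trig_poly A c z)"
    by (simp add: fourier_coeff_def mult.commute)
  also have "\<dots> = (\<Sum>k\<in>A. c k * fourier_coeff (\<lambda>z. z powi (- n)) (- k))"
    by (intro circ_int_mult_trig_poly L2_circ_L1 L2_circ_continuous continuous_powi_circ)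
  also have "\<dots> = (\<Sum>k\<in>A. if k = n then c k else 0)"
    unfolding fourier_coeff_powi by (intro sum.cong) auto
  finally show ?thesis using assms by simp
qed

lemma normsq_trig_poly:
  assumes "finite A"
  shows "normsq_circ (trig_poly A c) = (\<Sum>n\<in>A. (cmod (c n))\<^sup>2)"
proof -
  have "complex_of_real (normsq_circ (trig_poly A c)) = of_real (\<Sum>n\<in>A. (cmod (c n))\<^sup>2)"
    unfolding circ_int_mult_cnj[symmetric] circ_int_mult_cnj_trig_poly[OF L2_circ_L1[OF L2_trig_poly]]
    by (simp add: fourier_coeff_trig_poly assms complex_norm_square del: of_real_power)
  then show ?thesis by (simp only: of_real_eq_iff)
qed

text \<open>The remainder after subtracting the partial sum \<open>?S\<close> is orthogonal to
  \<open>?S\<close>, so its nonnegative squared norm is the difference of the two sides.\<close>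

lemma Bessel_circ:
  assumes f: "L2_circ f" and A: "finite A"
  shows "(\<Sum>n\<in>A. (cmod (fourier_coeff f n))\<^sup>2) \<le> normsq_circ f"
proof -
  let ?S = "trig_poly A (fourier_coeff f)"
  let ?g = "\<lambda>z. f z - ?S z"
  have g: "L2_circ ?g"
    by (intro L2_circ_diff f L2_trig_poly)
  have "of_real (normsq_circ ?g) = circ_int (\<lambda>z. (f z * cnj (f z) - f z * cnj (?S z)) - cnj (?g z * cnj (?S z)))"
    unfolding circ_int_mult_cnj[symmetric] by (intro circ_int_cong) (simp add: algebra_simps)
  also have "\<dots> = circ_int (\<lambda>z. f z * cnj (f z)) - circ_int (\<lambda>z. f z * cnj (?S z)) - circ_int (\<lambda>z. cnj (?g z * cnj (?S z)))"
  proof -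
    have "L1_circ (\<lambda>z. cnj (?g z * cnj (?S z)))"
      using L2_circ_mult_L1[OF L2_circ_cnj[OF g] L2_trig_poly] by simp
    then show ?thesis
      using f L2_trig_poly by (simp add: circ_int_diff L1_circ_diff L2_circ_mult_L1 L2_circ_cnj)
  qed
  also have "circ_int (\<lambda>z. cnj (?g z * cnj (?S z))) = 0"
    unfolding circ_int_cnj circ_int_mult_cnj_trig_poly[OF L2_circ_L1[OF g]]
    using f A by (simp add: fourier_coeff_diff L2_circ_L1 L2_trig_poly fourier_coeff_trig_poly)
  also have "circ_int (\<lambda>z. f z * cnj (?S z)) = of_real (\<Sum>n\<in>A. (cmod (fourier_coeff f n))\<^sup>2)"
    unfolding circ_int_mult_cnj_trig_poly[OF L2_circ_L1[OF f]]
    by (simp add: complex_norm_square del: of_real_power)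
  finally have "complex_of_real (normsq_circ ?g) =
      of_real (normsq_circ f - (\<Sum>n\<in>A. (cmod (fourier_coeff f n))\<^sup>2))"
    unfolding circ_int_mult_cnj by simp
  then have "normsq_circ ?g = normsq_circ f - (\<Sum>n\<in>A. (cmod (fourier_coeff f n))\<^sup>2)"
    by (simp only: of_real_eq_iff)
  then show ?thesis using normsq_circ_nonneg[of ?g] by simp
qed

text \<open>By orthonormality of the monomials the squared distance of two partial sums is the
  difference of two terms of the bounded increasing sequence \<open>s\<close>, so the partial sums
  are Cauchy and completeness applies.\<close>

theorem Riesz_Fischer_circ:
  assumes bound: "\<And>A. finite A \<Longrightarrow> (\<Sum>n\<in>A. (cmod (c n))\<^sup>2) \<le> B"
  shows "\<exists>f. L2_circ f \<and> (\<forall>n. fourier_coeff f n = c n) \<and>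
    (\<lambda>N. normsq_circ (\<lambda>z. trig_poly {- int N..int N} c z - f z)) \<longlonglongrightarrow> 0"
proof -
  define I where "I N = {- int N..int N}" for N
  define S where "S N = trig_poly (I N) c" for N
  define s where "s N = (\<Sum>n\<in>I N. (cmod (c n))\<^sup>2)" for N
  have [simp]: "finite (I N)" for N by (simp add: I_def)
  have mono: "I m \<subseteq> I n" if "m \<le> n" for m n
    using that by (auto simp: I_def)
  have "incseq s"
    unfolding s_def by (intro incseq_SucI sum_mono2) (auto simp: mono)
  moreover have "Bseq s"
  proof (rule BseqI')
    show "norm (s N) \<le> B" for N
      using bound[of "I N"] by (simp add: s_def sum_nonneg)
  qed
  ultimately have "Cauchy s"
    by (intro convergent_Cauchy Bseq_monoseq_convergent) (auto simp: monoseq_def incseq_def)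
  have L2S: "L2_circ (S N)" for N
    unfolding S_def by (rule L2_trig_poly)
  have Sdiff: "normsq_circ (\<lambda>z. S m z - S n z) = \<bar>s m - s n\<bar>" for m n
  proof -
    have *: "normsq_circ (\<lambda>z. S m z - S n z) = s m - s n" if "n \<le> m" for m n
    proof -
      have "(\<lambda>z. S m z - S n z) = trig_poly (I m - I n) c"
        unfolding S_def trig_poly_def by (intro ext, subst sum_diff) (auto simp: mono that)
      then have "normsq_circ (\<lambda>z. S m z - S n z) = (\<Sum>n\<in>I m - I n. (cmod (c n))\<^sup>2)"
        by (simp add: normsq_trig_poly)
      then show ?thesis
        unfolding s_def by (simp add: sum_diff mono that)
    qed
    have "normsq_circ (\<lambda>z. S m z - S n z) = normsq_circ (\<lambda>z. S n z - S m z)" for m n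
      by (simp add: normsq_circ_eq norm_minus_commute)
    then have "normsq_circ (\<lambda>z. S m z - S n z) = s m - s n \<or> normsq_circ (\<lambda>z. S m z - S n z) = - (s m - s n)"
      using *[of n m] *[of m n] by (cases "n \<le> m") auto
    then show ?thesis
      using normsq_circ_nonneg[of "\<lambda>z. S m z - S n z"] by auto
  qed
  have "\<exists>r. \<forall>e>0. \<exists>N. \<forall>n\<ge>N.
      (\<integral>\<^sup>+t. ennreal ((cmod (S n (cis t) - lim (\<lambda>k. S (r k) (cis t))))\<^sup>2) \<partial>circ_lebesgue) \<le> ennreal e"
  proof (rule L2_complete)
    show "(\<lambda>t. S n (cis t)) \<in> borel_measurable circ_lebesgue" for n
      using L2S[of n] by (auto simp: L2_circ_eq meas_circ_def)
    fix e :: real assume "e > 0"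
    then have "e / (2 * pi) > 0" by simp
    then obtain N where N: "\<And>m n. m \<ge> N \<Longrightarrow> n \<ge> N \<Longrightarrow> dist (s m) (s n) < e / (2*pi)"
      using \<open>Cauchy s\<close> unfolding Cauchy_def by meson
    have "(\<integral>\<^sup>+t. ennreal ((cmod (S m (cis t) - S n (cis t)))\<^sup>2) \<partial>circ_lebesgue) \<le> ennreal e"
      if "m \<ge> N" "n \<ge> N" for m n
    proof -
      have "(\<integral>\<^sup>+t. ennreal ((cmod (S m (cis t) - S n (cis t)))\<^sup>2) \<partial>circ_lebesgue) = ennreal (2 * pi * \<bar>s m - s n\<bar>)"
        using nn_integral_circ[OF L2_circ_diff[OF L2S L2S]] by (simp add: Sdiff)
      also have "\<dots> \<le> ennreal e"
        using N[OF that] by (intro ennreal_leI) (simp add: dist_real_def field_simps)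
      finally show ?thesis .
    qed
    then show "\<exists>N. \<forall>m\<ge>N. \<forall>n\<ge>N.
        (\<integral>\<^sup>+t. ennreal ((cmod (S m (cis t) - S n (cis t)))\<^sup>2) \<partial>circ_lebesgue) \<le> ennreal e"
      by blast
  qed
  then obtain r where r: "\<And>e. e > 0 \<Longrightarrow> \<exists>N. \<forall>n\<ge>N.
      (\<integral>\<^sup>+t. ennreal ((cmod (S n (cis t) - lim (\<lambda>k. S (r k) (cis t))))\<^sup>2) \<partial>circ_lebesgue) \<le> ennreal e"
    by blast
  \<comment> \<open>Taking the limit in the variable \<open>z\<close> makes \<open>f\<close> a
    function on the circle and not merely of the parameter \<open>t\<close>.\<close>
  define f where "f z = lim (\<lambda>k. S (r k) z)" for z
  have mf: "meas_circ f"
    unfolding meas_circ_def f_def using L2S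
    by (intro borel_measurable_lim_metric) (auto simp: L2_circ_eq meas_circ_def)
  have mSf: "meas_circ (\<lambda>z. S n z - f z)" for n
    using mf L2_circ_meas[OF L2S[of n]] unfolding meas_circ_def by measurable
  have L2I: "L2_circ (\<lambda>z. S n z - f z)"
    if "(\<integral>\<^sup>+t. ennreal ((cmod (S n (cis t) - f (cis t)))\<^sup>2) \<partial>circ_lebesgue) \<le> ennreal e" for n e
  proof -
    have "integrable circ_lebesgue (\<lambda>t. (cmod (S n (cis t) - f (cis t)))\<^sup>2)"
      using that mSf[of n] unfolding meas_circ_def
      by (intro integrableI_bounded) (auto simp: le_less_trans[OF _ ennreal_less_top])
    then show ?thesis using mSf by (simp add: L2_circ_eq)
  qed
  have f: "L2_circ f"
  proof -
    obtain n where "(\<integral>\<^sup>+t. ennreal ((cmod (S n (cis t) - f (cis t)))\<^sup>2) \<partial>circ_lebesgue) \<le> ennreal 1"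
      using r[of 1] by (auto simp: f_def)
    from L2_circ_diff[OF L2S[of n] L2I[OF this]] show ?thesis by simp
  qed
  have lim: "(\<lambda>N. normsq_circ (\<lambda>z. S N z - f z)) \<longlonglongrightarrow> 0"
  proof (rule LIMSEQ_I)
    fix e :: real assume "e > 0"
    then obtain N where N: "\<And>n. n \<ge> N \<Longrightarrow>
        (\<integral>\<^sup>+t. ennreal ((cmod (S n (cis t) - f (cis t)))\<^sup>2) \<partial>circ_lebesgue) \<le> ennreal e"
      using r[of e] by (auto simp: f_def)
    have "norm (normsq_circ (\<lambda>z. S n z - f z) - 0) < e" if "n \<ge> N" for n
    proof -
      have "ennreal (2 * pi * normsq_circ (\<lambda>z. S n z - f z)) \<le> ennreal e"
        using N[OF that] nn_integral_circ[OF L2_circ_diff[OF L2S f]] by simp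
      then have le: "2 * pi * normsq_circ (\<lambda>z. S n z - f z) \<le> e"
        using \<open>e > 0\<close> by (subst (asm) ennreal_le_iff) auto
      \<comment> \<open>The strict inequality comes from the normalisation, as
        \<open>2 * pi > 1\<close>.\<close>
      have "normsq_circ (\<lambda>z. S n z - f z) < e"
      proof (rule ccontr)
        assume "\<not> ?thesis"
        then have "e \<le> normsq_circ (\<lambda>z. S n z - f z)" by simp
        then have "2 * pi * e \<le> e"
          using le by (meson mult_left_mono order_trans pi_ge_zero zero_le_mult_iff zero_le_numeral)
        moreover have "1 * e < 2 * pi * e"
          using \<open>e > 0\<close> pi_ge_two by (intro mult_strict_right_mono) auto
        ultimately show False by simp
      qed
      then show ?thesis using normsq_circ_nonneg by simp
    qed
    then show "\<exists>no. \<forall>n\<ge>no. norm (normsq_circ (\<lambda>z. S n z - f z) - 0) < e"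
      by blast
  qed
  have "fourier_coeff f k = c k" for k
  proof -
    \<comment> \<open>Bessel's inequality for the single index \<open>k\<close>, as soon as the
      partial sum contains that index.\<close>
    have le: "(cmod (c k - fourier_coeff f k))\<^sup>2 \<le> normsq_circ (\<lambda>z. S n z - f z)" if "nat \<bar>k\<bar> \<le> n" for n
    proof -
      have "k \<in> I n" using that by (auto simp: I_def)
      then have "fourier_coeff (\<lambda>z. S n z - f z) k = c k - fourier_coeff f k"
        using f L2S by (simp add: fourier_coeff_diff L2_circ_L1) (simp add: S_def fourier_coeff_trig_poly)
      then show ?thesis
        using Bessel_circ[OF L2_circ_diff[OF L2S[of n] f], of "{k}"] by simp
    qed
    have "(cmod (c k - fourier_coeff f k))\<^sup>2 \<le> 0"
      by (rule LIMSEQ_le_const[OF lim]) (use le in blast)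
    then show ?thesis by simp
  qed
  with f lim show ?thesis
    unfolding S_def I_def by blast
qed

text \<open>Riesz-Fischer builds a function from the coefficients of \<open>f\<close>, and
  uniqueness of coefficients identifies it with \<open>f\<close> almost everywhere.\<close>

lemma L2_circ_fourier_series:
  assumes f: "L2_circ f"
  shows "(\<lambda>N. normsq_circ (\<lambda>z. trig_poly {- int N..int N} (fourier_coeff f) z - f z)) \<longlonglongrightarrow> 0"
proof -
  obtain g where g: "L2_circ g" "\<And>n. fourier_coeff g n = fourier_coeff f n"
    and lim: "(\<lambda>N. normsq_circ (\<lambda>z. trig_poly {- int N..int N} (fourier_coeff f) z - g z)) \<longlonglongrightarrow> 0"
    using Riesz_Fischer_circ[OF Bessel_circ[OF f]] by blast
  have "circ_ae (\<lambda>z. f z - g z = 0)"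
    using f g by (intro fourier_coeff_unique_zero) (auto simp: fourier_coeff_diff L2_circ_L1 L1_circ_diff)
  then have "normsq_circ (\<lambda>z. trig_poly {- int N..int N} (fourier_coeff f) z - g z) =
      normsq_circ (\<lambda>z. trig_poly {- int N..int N} (fourier_coeff f) z - f z)" for N
    using f g by (intro normsq_circ_cong_ae L2_circ_meas L2_circ_diff L2_trig_poly) (auto elim: circ_ae_mono)
  with lim show ?thesis by simp
qed

text \<open>The consequence of Parseval's identity on which later orthogonality arguments rest: each
  partial sum of \<open>f\<close> integrates to zero against \<open>g\<close>, and the partial sums
  converge to \<open>f\<close> in norm.\<close>

lemma circ_int_mult_eq_0:
  assumes f: "L2_circ f" and g: "L2_circ g"
    and zero: "\<And>n. fourier_coeff f n = 0 \<or> fourier_coeff g (- n) = 0"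
  shows "circ_int (\<lambda>z. f z * g z) = 0"
proof -
  define S where "S N = trig_poly {- int N..int N} (fourier_coeff f)" for N
  have L2S: "L2_circ (S N)" for N
    unfolding S_def by (rule L2_trig_poly)
  have eq: "circ_int (\<lambda>z. f z * g z) = - circ_int (\<lambda>z. (S N z - f z) * g z)" for N
  proof -
    have "circ_int (\<lambda>z. S N z * g z) = (\<Sum>n\<in>{- int N..int N}. fourier_coeff f n * fourier_coeff g (- n))"
      using circ_int_mult_trig_poly[OF L2_circ_L1[OF g]] by (simp add: S_def mult.commute)
    also have "\<dots> = 0"
      using zero by (intro sum.neutral) auto
    finally show ?thesis
      using f g L2S by (simp add: left_diff_distrib circ_int_diff L2_circ_mult_L1)
  qed
  have "cmod (circ_int (\<lambda>z. f z * g z)) \<le> 0 + e" if "e > 0" for e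
  proof -
    \<comment> \<open>This weight keeps the second term of the estimate below \<open>e\<close> for
      every \<open>N\<close>; with \<open>d\<close> fixed, the first term tends to zero.\<close>
    define d where "d = e / (normsq_circ g + 1)"
    have g0: "normsq_circ g \<ge> 0" by (rule normsq_circ_nonneg)
    have d: "d > 0" "d * normsq_circ g \<le> e"
      using that g0 by (auto simp: d_def field_simps)
    have "cmod (circ_int (\<lambda>z. f z * g z)) \<le> normsq_circ (\<lambda>z. S N z - f z) / d + d * normsq_circ g" for N
      using cmod_circ_int_mult_le[OF L2_circ_diff[OF L2S[of N] f] g d(1)] eq[of N] by simp
    moreover have "(\<lambda>N. normsq_circ (\<lambda>z. S N z - f z) / d + d * normsq_circ g) \<longlonglongrightarrow> 0 / d + d * normsq_circ g"
      using L2_circ_fourier_series[OF f] d unfolding S_def by (intro tendsto_intros) auto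
    ultimately have "cmod (circ_int (\<lambda>z. f z * g z)) \<le> 0 / d + d * normsq_circ g"
      by (intro LIMSEQ_le_const) auto
    with d show ?thesis by simp
  qed
  then have "cmod (circ_int (\<lambda>z. f z * g z)) \<le> 0"
    by (rule field_le_epsilon)
  then show ?thesis by simp
qed

text \<open>The Riesz projection: dropping the negative coefficients preserves the Bessel bound, so
  Riesz-Fischer supplies the function.\<close>

lemma H2_projection:
  assumes f: "L2_circ f"
  obtains h where "H2 h" "\<And>n. n \<ge> 0 \<Longrightarrow> fourier_coeff h n = fourier_coeff f n"
proof -
  define c where "c n = (if n \<ge> 0 then fourier_coeff f n else 0)" for n
  have "(\<Sum>n\<in>A. (cmod (c n))\<^sup>2) \<le> normsq_circ f" if "finite A" for A
  proof -
    have "(\<Sum>n\<in>A. (cmod (c n))\<^sup>2) \<le> (\<Sum>n\<in>A. (cmod (fourier_coeff f n))\<^sup>2)"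
      by (intro sum_mono) (auto simp: c_def)
    also have "\<dots> \<le> normsq_circ f"
      using f that by (rule Bessel_circ)
    finally show ?thesis .
  qed
  from Riesz_Fischer_circ[OF this] obtain h where "L2_circ h" "\<And>n. fourier_coeff h n = c n"
    by blast
  then show ?thesis
    by (intro that[of h]) (auto simp: H2_def c_def)
qed

subsection \<open>Hardy spaces\<close>

lemma H2_L2: "H2 f \<Longrightarrow> L2_circ f"
  by (simp add: H2_def)

lemma H2_const [simp]: "H2 (\<lambda>z. c)"
  by (simp add: H2_def fourier_coeff_const)

lemma H2_diff: "H2 f \<Longrightarrow> H2 g \<Longrightarrow> H2 (\<lambda>z. f z - g z)"
  by (simp add: H2_def L2_circ_diff fourier_coeff_diff L2_circ_L1)

lemma H2_shift:
  assumes f: "H2 f" and m: "m \<ge> 0"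
  shows "H2 (\<lambda>z. z powi m * f z)"
proof -
  have "L2_circ (\<lambda>z. z powi m * f z)"
    using f by (intro L2_circ_continuous_mult continuous_powi_circ H2_L2)
  then show ?thesis
    using f m by (simp add: H2_def fourier_coeff_shift)
qed

text \<open>A product of two such functions is in general only integrable, so its coefficient is
  read as a pairing of \<open>f\<close> with a shift of \<open>g\<close>: for \<open>k >= 0\<close>
  the shifted function has coefficient 0 at \<open>- k\<close>.\<close>

lemma fourier_coeff_mult_H2:
  assumes f: "H2 f" and g: "H2 g" and n: "n < 0"
  shows "fourier_coeff (\<lambda>z. f z * g z) n = 0"
proof -
  have "circ_int (\<lambda>z. f z * (z powi (- n) * g z)) = 0"
  proof (rule circ_int_mult_eq_0)
    show "L2_circ (\<lambda>z. z powi (- n) * g z)"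
      using g by (intro L2_circ_continuous_mult continuous_powi_circ H2_L2)
    show "fourier_coeff f k = 0 \<or> fourier_coeff (\<lambda>z. z powi (- n) * g z) (- k) = 0" for k
    proof (cases "k < 0")
      case False
      then have "- k - - n < 0" using n by simp
      then show ?thesis using g unfolding fourier_coeff_shift H2_def by blast
    qed (use f in \<open>simp add: H2_def\<close>)
  qed (use f in \<open>simp add: H2_def\<close>)
  then show ?thesis
    by (simp add: fourier_coeff_def mult_ac)
qed

lemma Hinf_H2: "Hinf f \<Longrightarrow> H2 f"
  by (simp add: Hinf_def)

lemma Hinf_mult_L2:
  assumes f: "Hinf f" and g: "L2_circ g"
  shows "L2_circ (\<lambda>z. f z * g z)"
proof -
  obtain B where "circ_ae (\<lambda>z. cmod (f z) \<le> B)"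
    using f by (auto simp: Hinf_def)
  then show ?thesis
    using f g by (intro L2_circ_bounded_mult) (auto simp: Hinf_def H2_def)
qed

lemma Hinf_mult_H2:
  assumes f: "Hinf f" and g: "H2 g"
  shows "H2 (\<lambda>z. f z * g z)"
  using fourier_coeff_mult_H2[OF Hinf_H2[OF f] g] Hinf_mult_L2[OF f H2_L2[OF g]]
  by (simp add: H2_def)

lemma Hinf_mult:
  assumes f: "Hinf f" and g: "Hinf g"
  shows "Hinf (\<lambda>z. f z * g z)"
proof -
  obtain A B where "circ_ae (\<lambda>z. cmod (f z) \<le> A)" "circ_ae (\<lambda>z. cmod (g z) \<le> B)"
    using f g by (auto simp: Hinf_def)
  then have "circ_ae (\<lambda>z. cmod (f z) \<le> A \<and> cmod (g z) \<le> B)"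
    by (rule circ_ae_conj)
  then have "circ_ae (\<lambda>z. cmod (f z * g z) \<le> A * B)"
    by (rule circ_ae_mono) (auto simp: norm_mult intro!: mult_mono intro: order_trans[OF norm_ge_zero])
  then show ?thesis
    using Hinf_mult_H2[OF f Hinf_H2[OF g]] by (auto simp: Hinf_def)
qed

lemma Hinf_diff:
  assumes f: "Hinf f" and g: "Hinf g"
  shows "Hinf (\<lambda>z. f z - g z)"
proof -
  obtain A B where "circ_ae (\<lambda>z. cmod (f z) \<le> A)" "circ_ae (\<lambda>z. cmod (g z) \<le> B)"
    using f g by (auto simp: Hinf_def)
  then have "circ_ae (\<lambda>z. cmod (f z) \<le> A \<and> cmod (g z) \<le> B)"
    by (rule circ_ae_conj)
  then have "circ_ae (\<lambda>z. cmod (f z - g z) \<le> A + B)"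
    by (rule circ_ae_mono) (auto intro: order_trans[OF norm_triangle_ineq4])
  then show ?thesis
    using f g by (auto simp: Hinf_def H2_diff)
qed

lemma Hinf_const [simp]: "Hinf (\<lambda>z. c)"
  by (auto simp: Hinf_def circ_ae_eq)

lemma H2_continuous_Hinf:
  assumes "H2 f" "continuous_on (sphere 0 1) f"
  shows "Hinf f"
  using assms continuous_circ_bounded[of f] by (auto simp: Hinf_def circ_ae_eq)

subsection \<open>The analytic extension to the disk\<close>

lemma cauchy_kernel_neq: "cmod w < 1 \<Longrightarrow> cmod z = 1 \<Longrightarrow> 1 - w * z \<noteq> 0"
proof
  assume "cmod w < 1" "cmod z = 1" "1 - w * z = 0"
  then have "cmod (w * z) = 1" by (metis eq_iff_diff_eq_0 norm_one)
  with \<open>cmod w < 1\<close> \<open>cmod z = 1\<close> show False by (simp add: norm_mult)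
qed

lemma continuous_cauchy_kernel:
  assumes "cmod w < 1"
  shows "continuous_on (sphere 0 1) (\<lambda>z. 1 / (1 - w * cnj z))"
  using cauchy_kernel_neq[OF assms] by (intro continuous_intros) auto

lemma ext_disk_L1:
  assumes "L1_circ f" "cmod w < 1"
  shows "L1_circ (\<lambda>z. f z / (1 - w * cnj z))"
  using L1_circ_continuous_mult[OF assms(1) continuous_cauchy_kernel[OF assms(2)]] by simp

text \<open>On the circle \<open>cnj z\<close> is the inverse of \<open>z\<close>, so the Cauchy
  kernel expands into a geometric series. The remainder carries the factor
  \<open>(w * cnj z) ^ N\<close> and is bounded uniformly in \<open>z\<close> by a multiple of
  \<open>cmod w ^ N\<close>.\<close>

lemma ext_disk_sums:
  assumes f: "L1_circ f" and w: "cmod w < 1"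
  shows "(\<lambda>n. fourier_coeff f (int n) * w ^ n) sums ext_disk f w"
proof -
  define I where "I = (LINT t|circ_lebesgue. cmod (f (cis t)))"
  let ?K = "\<lambda>z. 1 / (1 - w * cnj z)"
  have K: "meas_circ (\<lambda>z. (w * cnj z) ^ N * ?K z)" for N
    by (intro meas_circ_continuous continuous_on_mult[OF _ continuous_cauchy_kernel[OF w]] continuous_intros)
  have diff: "ext_disk f w - (\<Sum>n<N. fourier_coeff f (int n) * w ^ n) =
      circ_int (\<lambda>z. ((w * cnj z) ^ N * ?K z) * f z)" for N
  proof -
    have "(\<Sum>n<N. fourier_coeff f (int n) * w ^ n) = (\<Sum>n<N. circ_int (\<lambda>z. w ^ n * (f z * z powi (- int n))))"
      by (simp add: fourier_coeff_def mult.commute)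
    also have "\<dots> = circ_int (\<lambda>z. \<Sum>n<N. w ^ n * (f z * z powi (- int n)))"
      using f by (intro circ_int_sum[symmetric] L1_circ_cmult fourier_coeff_L1)
    finally have *: "ext_disk f w - (\<Sum>n<N. fourier_coeff f (int n) * w ^ n) =
        circ_int (\<lambda>z. f z / (1 - w * cnj z)) - circ_int (\<lambda>z. \<Sum>n<N. w ^ n * (f z * z powi (- int n)))"
      by (simp add: ext_disk_def)
    have "L1_circ (\<lambda>z. \<Sum>n<N. w ^ n * (f z * z powi (- int n)))"
      using L1_circ_cmult[OF fourier_coeff_L1[OF f]] by (simp add: L1_circ_def)
    then have "ext_disk f w - (\<Sum>n<N. fourier_coeff f (int n) * w ^ n) =
        circ_int (\<lambda>z. f z / (1 - w * cnj z) - (\<Sum>n<N. w ^ n * (f z * z powi (- int n))))"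
      unfolding * using f w by (intro circ_int_diff[symmetric] ext_disk_L1)
    also have "\<dots> = circ_int (\<lambda>z. ((w * cnj z) ^ N * ?K z) * f z)"
    proof (rule circ_int_cong)
      fix z :: complex assume z: "cmod z = 1"
      then have nz: "1 - w * cnj z \<noteq> 0"
        using cauchy_kernel_neq[OF w, of "cnj z"] by simp
      have "z powi (- int n) = cnj z ^ n" for n
        using powi_circ_cnj[OF z, of "int n"] by simp
      then have "(\<Sum>n<N. w ^ n * (f z * z powi (- int n))) = f z * (\<Sum>n<N. (w * cnj z) ^ n)"
        by (simp add: sum_distrib_left power_mult_distrib mult_ac)
      also have "(\<Sum>n<N. (w * cnj z) ^ n) = (1 - (w * cnj z) ^ N) / (1 - w * cnj z)"
        using nz by (subst sum_gp_strict) auto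
      finally show "f z / (1 - w * cnj z) - (\<Sum>n<N. w ^ n * (f z * z powi (- int n))) =
          ((w * cnj z) ^ N * ?K z) * f z"
        using nz by (simp add: field_simps)
    qed
    finally show ?thesis .
  qed
  have le: "cmod (circ_int (\<lambda>z. ((w * cnj z) ^ N * ?K z) * f z)) \<le> (cmod w ^ N * (1 / (1 - cmod w))) * I" for N
    unfolding I_def
  proof (rule norm_circ_int_le[OF f _ K])
    fix z :: complex assume z: "cmod z = 1"
    have "1 - cmod w \<le> cmod (1 - w * cnj z)"
      using norm_triangle_ineq2[of 1 "w * cnj z"] z by (simp add: norm_mult)
    then have "1 / cmod (1 - w * cnj z) \<le> 1 / (1 - cmod w)"
      using w by (intro divide_left_mono mult_pos_pos) auto
    then show "cmod ((w * cnj z) ^ N * ?K z) \<le> cmod w ^ N * (1 / (1 - cmod w))"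
      using z by (simp add: norm_mult norm_power norm_divide mult_left_mono del: times_divide_eq_right)
  qed
  have "(\<lambda>N. ext_disk f w - (\<Sum>n<N. fourier_coeff f (int n) * w ^ n)) \<longlonglongrightarrow> 0"
  proof (rule Lim_null_comparison)
    show "\<forall>\<^sub>F N in sequentially. norm (ext_disk f w - (\<Sum>n<N. fourier_coeff f (int n) * w ^ n))
        \<le> (cmod w ^ N * (1 / (1 - cmod w))) * I"
      unfolding diff using le by simp
    have "(\<lambda>N. (cmod w ^ N * (1 / (1 - cmod w))) * I) \<longlonglongrightarrow> (0 * (1 / (1 - cmod w))) * I"
      using w by (intro tendsto_intros LIMSEQ_power_zero) simp
    then show "(\<lambda>N. (cmod w ^ N * (1 / (1 - cmod w))) * I) \<longlonglongrightarrow> 0" by simp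
  qed
  from tendsto_diff[OF tendsto_const[of "ext_disk f w"] this] show ?thesis
    by (simp add: sums_def)
qed

text \<open>The identity theorem for power series, applied at the origin; convergence at the single
  point \<open>1/2\<close> already gives a positive radius.\<close>

lemma ext_disk_eq_imp_fourier_coeff_eq:
  assumes f: "L1_circ f" and g: "L1_circ g"
    and eq: "\<And>w. cmod w < 1 \<Longrightarrow> ext_disk f w = ext_disk g w" and n: "n \<ge> 0"
  shows "fourier_coeff f n = fourier_coeff g n"
proof -
  define F where "F f = Abs_fps (\<lambda>n. fourier_coeff f (int n))" for f
  have rad: "fps_conv_radius (F f) > 0" if "L1_circ f" for f
  proof -
    have "summable (\<lambda>n. fourier_coeff f (int n) * (1/2) ^ n)"
      using ext_disk_sums[OF that, of "1/2"] by (auto simp: sums_iff norm_divide)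
    then have "conv_radius (\<lambda>n. fourier_coeff f (int n)) \<ge> norm (1/2 :: complex)"
      by (rule conv_radius_geI)
    then have "conv_radius (\<lambda>n. fourier_coeff f (int n)) \<ge> ereal (1/2)"
      by (simp add: norm_divide)
    then show ?thesis
      unfolding F_def fps_conv_radius_def by (auto intro: less_le_trans[rotated])
  qed
  have eval: "eval_fps (F f) w = ext_disk f w" if "L1_circ f" "cmod w < 1" for f w
    using ext_disk_sums[OF that] by (simp add: eval_fps_def F_def sums_iff)
  have "F f = F g"
  proof (rule eval_fps_eqD[OF rad[OF f] rad[OF g]])
    have "eventually (\<lambda>w::complex. w \<in> ball 0 1) (nhds 0)"
      by (rule eventually_nhds_in_open) auto
    then show "eventually (\<lambda>w. eval_fps (F f) w = eval_fps (F g) w) (nhds 0)"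
      by eventually_elim (auto simp: eval f g eq)
  qed
  then have "fps_nth (F f) (nat n) = fps_nth (F g) (nat n)" by simp
  then show ?thesis using n by (simp add: F_def)
qed

lemma ext_disk_cong_fourier_coeff:
  assumes "L1_circ f" "L1_circ g" "\<And>n. n \<ge> 0 \<Longrightarrow> fourier_coeff f n = fourier_coeff g n" "cmod w < 1"
  shows "ext_disk f w = ext_disk g w"
  using ext_disk_sums[of f w] ext_disk_sums[of g w] assms sums_unique2 by fastforce

lemma ext_disk_diff:
  assumes "L1_circ f" "L1_circ g" "cmod w < 1"
  shows "ext_disk (\<lambda>z. f z - g z) w = ext_disk f w - ext_disk g w"
  unfolding ext_disk_def using assms by (simp add: diff_divide_distrib circ_int_diff ext_disk_L1)

lemma ext_disk_0: "ext_disk f 0 = fourier_coeff f 0"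
  by (simp add: ext_disk_def fourier_coeff_def)

lemma ext_disk_const:
  assumes "cmod w < 1"
  shows "ext_disk (\<lambda>z. c) w = c"
proof -
  have "(\<lambda>n. fourier_coeff (\<lambda>z. c) (int n) * w ^ n) sums (fourier_coeff (\<lambda>z. c) (int 0) * w ^ 0)"
    by (rule sums_single[of 0, THEN sums_cong[THEN iffD1, rotated]]) (auto simp: fourier_coeff_const)
  then show ?thesis
    using ext_disk_sums[OF L2_circ_L1[OF L2_circ_const] assms] sums_unique2
    by (fastforce simp: fourier_coeff_const)
qed

lemma ext_disk_shift:
  assumes f: "H2 f" and w: "cmod w < 1"
  shows "ext_disk (\<lambda>z. z ^ m * f z) w = w ^ m * ext_disk f w"
proof (induction m)
  case 0
  then show ?case by simp
next
  case (Suc m)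
  let ?g = "\<lambda>z. z ^ m * f z"
  have gH: "H2 ?g"
    using H2_shift[OF f, of "int m"] by simp
  then have g: "L1_circ ?g"
    by (intro L2_circ_L1 H2_L2)
  have "ext_disk (\<lambda>z. z ^ (Suc m) * f z) w = circ_int (\<lambda>z. ?g z * z powi 1 + w * (?g z / (1 - w * cnj z)))"
    unfolding ext_disk_def
  proof (rule circ_int_cong)
    fix z :: complex assume z: "cmod z = 1"
    then have nz: "1 - w * cnj z \<noteq> 0"
      using cauchy_kernel_neq[OF w, of "cnj z"] by simp
    have zz: "z * cnj z = 1"
      using z complex_norm_square[of z] by simp
    \<comment> \<open>Splitting \<open>z / (1 - w * cnj z)\<close> into
      \<open>z + w / (1 - w * cnj z)\<close> produces the coefficient at \<open>-1\<close>, which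
      vanishes in H2, and \<open>w\<close> times the extension of \<open>?g\<close>.\<close>
    have "z = z * (1 - w * cnj z) + w"
      using zz by (simp add: algebra_simps)
    then have "z / (1 - w * cnj z) = z + w / (1 - w * cnj z)"
      using nz by (simp add: field_simps)
    then have "?g z * (z / (1 - w * cnj z)) = ?g z * (z + w / (1 - w * cnj z))"
      by simp
    then show "z ^ Suc m * f z / (1 - w * cnj z) = ?g z * z powi 1 + w * (?g z / (1 - w * cnj z))"
      by (simp add: algebra_simps)
  qed
  also have "\<dots> = fourier_coeff ?g (-1) + w * ext_disk ?g w"
  proof -
    have "L1_circ (\<lambda>z. ?g z * z powi 1)" by (rule fourier_coeff_L1[OF g])
    moreover have "L1_circ (\<lambda>z. w * (?g z / (1 - w * cnj z)))"
      by (intro L1_circ_cmult ext_disk_L1 g w)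
    ultimately show ?thesis
      unfolding ext_disk_def fourier_coeff_def circ_int_cmult[symmetric] by (subst circ_int_add) auto
  qed
  also have "fourier_coeff ?g (-1) = 0"
    using gH unfolding H2_def by auto
  finally show ?case using Suc.IH by simp
qed

text \<open>
  With \<open>c = g(w)\<close>, the function \<open>p = (g - c) / (1 - w cnj z)\<close> equals \<open>z (g - g(w)) / (z - w)\<close> on the circle,
  so it lies in \<open>z H\<^sup>2\<close> and \<open>f p\<close> has mean zero.
\<close>
lemma ext_disk_mult:
  assumes f: "H2 f" and g: "H2 g" and w: "cmod w < 1"
  shows "ext_disk (\<lambda>z. f z * g z) w = ext_disk f w * ext_disk g w"
proof -
  define c where "c = ext_disk g w"
  let ?p = "\<lambda>z. 1 / (1 - w * cnj z) * (g z - c)"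
  have gc: "H2 (\<lambda>z. g z - c)"
    by (intro H2_diff g H2_const)
  have p: "L2_circ ?p"
    using gc continuous_cauchy_kernel[OF w] by (intro L2_circ_continuous_mult H2_L2)
  \<comment> \<open>The coefficient at \<open>- n\<close> is the extension of
    \<open>z ^ n * (g z - c)\<close> at \<open>w\<close>, which has the factor
    \<open>g(w) - c\<close>. The index \<open>n = 0\<close> is included, and this is what gives the
    product with \<open>f\<close> mean zero.\<close>
  have neg: "fourier_coeff ?p (- n) = 0" if "n \<ge> 0" for n
  proof -
    have "fourier_coeff ?p (- n) = ext_disk (\<lambda>z. z ^ nat n * (g z - c)) w"
      using that by (simp add: fourier_coeff_def ext_disk_def power_int_def mult_ac)
    also have "\<dots> = w ^ nat n * (ext_disk g w - c)"
      using g w by (simp add: ext_disk_shift[OF gc w] ext_disk_diff ext_disk_const L2_circ_L1 H2_L2)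
    finally show ?thesis by (simp add: c_def)
  qed
  have zero: "circ_int (\<lambda>z. f z * ?p z) = 0"
  proof (rule circ_int_mult_eq_0[OF H2_L2[OF f] p])
    fix n
    show "fourier_coeff f n = 0 \<or> fourier_coeff ?p (- n) = 0"
      using f neg[of n] unfolding H2_def by (meson not_less)
  qed
  have "ext_disk (\<lambda>z. f z * g z) w = circ_int (\<lambda>z. f z * ?p z + c * (f z / (1 - w * cnj z)))"
    unfolding ext_disk_def by (intro circ_int_cong) (simp add: diff_divide_distrib algebra_simps)
  also have "\<dots> = circ_int (\<lambda>z. f z * ?p z) + c * ext_disk f w"
    unfolding ext_disk_def circ_int_cmult[symmetric]
    by (intro circ_int_add L2_circ_mult_L1[OF H2_L2[OF f] p] L1_circ_cmult
        ext_disk_L1[OF L2_circ_L1[OF H2_L2[OF f]] w])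
  finally show ?thesis using zero by (simp add: c_def)
qed

subsection \<open>Model spaces\<close>

lemma inner_fun_Hinf: "inner_fun a \<Longrightarrow> Hinf a"
  by (simp add: inner_fun_def)

lemma inner_fun_cnj_mult_L2:
  assumes a: "inner_fun a" and f: "L2_circ f"
  shows "L2_circ (\<lambda>z. cnj (a z) * f z)"
proof (rule L2_circ_bounded_mult[OF f])
  show "meas_circ (\<lambda>z. cnj (a z))"
    using a by (intro meas_circ_cnj L2_circ_meas H2_L2 Hinf_H2 inner_fun_Hinf)
  show "circ_ae (\<lambda>z. cmod (cnj (a z)) \<le> 1)"
    using a unfolding inner_fun_def by (auto elim: circ_ae_mono)
qed

lemma circ_ae_inner_cnj_mult: "inner_fun a \<Longrightarrow> circ_ae (\<lambda>z. cnj (a z) * (a z * h z) = h z)"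
  unfolding inner_fun_def
proof (elim conjE, erule circ_ae_mono)
  fix z assume "cmod (a z) = 1"
  then have "cnj (a z) * a z = 1"
    using complex_norm_square[of "a z"] by (simp add: mult.commute)
  then show "cnj (a z) * (a z * h z) = h z" by (simp add: mult.assoc[symmetric])
qed

text \<open>Conjugating the kernel on the circle leaves a difference of two Cauchy integrals. The
  formula expresses the projection onto the model space as the Riesz projection of \<open>f\<close>
  minus \<open>a\<close> times that of \<open>cnj a * f\<close>.\<close>

lemma ip_circ_repr_kernel:
  assumes a: "inner_fun a" and f: "L2_circ f" and w: "cmod w < 1"
  shows "ip_circ f (repr_kernel a w) = ext_disk f w - ext_disk a w * ext_disk (\<lambda>z. cnj (a z) * f z) w"
proof -
  have "ip_circ f (repr_kernel a w) =
      circ_int (\<lambda>z. f z / (1 - w * cnj z) - ext_disk a w * ((cnj (a z) * f z) / (1 - w * cnj z)))"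
    unfolding ip_circ_def repr_kernel_def by (intro circ_int_cong) (simp add: diff_divide_distrib algebra_simps)
  also have "\<dots> = ext_disk f w - ext_disk a w * ext_disk (\<lambda>z. cnj (a z) * f z) w"
    unfolding ext_disk_def[of f] ext_disk_def[of "\<lambda>z. cnj (a z) * f z"] circ_int_cmult[symmetric]
    using assms by (intro circ_int_diff L1_circ_cmult ext_disk_L1 L2_circ_L1 inner_fun_cnj_mult_L2)
  finally show ?thesis .
qed

text \<open>The coefficient at \<open>n\<close> is the conjugate of the Cauchy integral of
  \<open>z powi n\<close>, which for \<open>n < 0\<close> has no coefficient at a nonnegative
  index.\<close>

lemma Hinf_cauchy_kernel:
  assumes w: "cmod w < 1"
  shows "Hinf (\<lambda>z. 1 / (1 - cnj w * z))"
proof (rule H2_continuous_Hinf)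
  show c: "continuous_on (sphere 0 1) (\<lambda>z. 1 / (1 - cnj w * z))"
    using cauchy_kernel_neq[of "cnj w"] w by (intro continuous_intros) auto
  have "fourier_coeff (\<lambda>z. 1 / (1 - cnj w * z)) n = 0" if "n < 0" for n
  proof -
    have "fourier_coeff (\<lambda>z. 1 / (1 - cnj w * z)) n = cnj (ext_disk (\<lambda>z. z powi n) w)"
      unfolding fourier_coeff_def ext_disk_def circ_int_cnj[symmetric]
      by (intro circ_int_cong) (simp add: powi_circ_cnj del: complex_cnj_power_int)
    also have "ext_disk (\<lambda>z. z powi n) w = ext_disk (\<lambda>z. 0) w"
      using w that
      by (intro ext_disk_cong_fourier_coeff L2_circ_L1 L2_circ_continuous continuous_powi_circ)
        (auto simp: fourier_coeff_powi fourier_coeff_const)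
    finally show ?thesis using w by (simp add: ext_disk_const)
  qed
  then show "H2 (\<lambda>z. 1 / (1 - cnj w * z))"
    using c by (simp add: H2_def L2_circ_continuous)
qed

text \<open>Pairing \<open>a * h\<close> with the kernel gives \<open>a(w) h(w) - a(w) h(w)\<close>,
  because \<open>cnj a * a = 1\<close> almost everywhere and the disk extension is
  multiplicative.\<close>

lemma model_space_inf_repr_kernel:
  assumes a: "inner_fun a" and w: "cmod w < 1"
  shows "model_space_inf a (repr_kernel a w)"
proof -
  have "Hinf (\<lambda>z. 1 / (1 - cnj w * z) * (1 - cnj (ext_disk a w) * a z))"
    using a w by (intro Hinf_mult Hinf_diff Hinf_cauchy_kernel Hinf_const inner_fun_Hinf)
  then have k: "Hinf (repr_kernel a w)"
    by (simp add: repr_kernel_def[abs_def])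
  have "ip_circ (repr_kernel a w) (\<lambda>z. a z * h z) = 0" if h: "H2 h" for h
  proof -
    have ah: "H2 (\<lambda>z. a z * h z)"
      using a h by (intro Hinf_mult_H2 inner_fun_Hinf)
    have "ip_circ (\<lambda>z. a z * h z) (repr_kernel a w) =
        ext_disk (\<lambda>z. a z * h z) w - ext_disk a w * ext_disk (\<lambda>z. cnj (a z) * (a z * h z)) w"
      using ip_circ_repr_kernel[OF a H2_L2[OF ah] w] .
    also have "ext_disk (\<lambda>z. cnj (a z) * (a z * h z)) w = ext_disk h w"
      using a h ah w circ_ae_inner_cnj_mult[OF a, of h]
      by (intro ext_disk_cong_fourier_coeff fourier_coeff_cong_ae L2_circ_L1 L2_circ_meas
          inner_fun_cnj_mult_L2 H2_L2)
    also have "ext_disk (\<lambda>z. a z * h z) w = ext_disk a w * ext_disk h w"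
      by (rule ext_disk_mult[OF Hinf_H2[OF inner_fun_Hinf[OF a]] h w])
    finally have "ip_circ (\<lambda>z. a z * h z) (repr_kernel a w) = 0" by simp
    moreover have "ip_circ (repr_kernel a w) (\<lambda>z. a z * h z) = cnj (ip_circ (\<lambda>z. a z * h z) (repr_kernel a w))"
      unfolding ip_circ_def circ_int_cnj[symmetric] by (simp add: mult.commute)
    ultimately show ?thesis by simp
  qed
  with k show ?thesis
    by (simp add: model_space_inf_def model_space_def Hinf_def)
qed

text \<open>Orthogonality to the kernels equates the disk extensions of \<open>F\<close> and
  \<open>b * h\<close>. These determine only the coefficients at nonnegative indices; the negative
  part of \<open>F\<close> stays arbitrary.\<close>

lemma orthogonal_kernels_imp_fourier_coeff:
  assumes b: "inner_fun b" and F: "L2_circ F"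
    and orth: "\<And>w. cmod w < 1 \<Longrightarrow> ip_circ F (repr_kernel b w) = 0"
  obtains h where "H2 h" "\<And>n. n \<ge> 0 \<Longrightarrow> fourier_coeff F n = fourier_coeff (\<lambda>z. b z * h z) n"
proof -
  have bF: "L2_circ (\<lambda>z. cnj (b z) * F z)"
    by (rule inner_fun_cnj_mult_L2[OF b F])
  obtain h where h: "H2 h" and fc: "\<And>n. n \<ge> 0 \<Longrightarrow> fourier_coeff h n = fourier_coeff (\<lambda>z. cnj (b z) * F z) n"
    using H2_projection[OF bF] by blast
  have "ext_disk F w = ext_disk (\<lambda>z. b z * h z) w" if w: "cmod w < 1" for w
  proof -
    have "ext_disk F w = ext_disk b w * ext_disk (\<lambda>z. cnj (b z) * F z) w"
      using orth[OF w] ip_circ_repr_kernel[OF b F w] by simp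
    also have "ext_disk (\<lambda>z. cnj (b z) * F z) w = ext_disk h w"
      using fc w by (intro ext_disk_cong_fourier_coeff L2_circ_L1[OF bF] L2_circ_L1[OF H2_L2[OF h]]) auto
    also have "ext_disk b w * ext_disk h w = ext_disk (\<lambda>z. b z * h z) w"
      by (rule ext_disk_mult[OF Hinf_H2[OF inner_fun_Hinf[OF b]] h w, symmetric])
    finally show ?thesis .
  qed
  then have "fourier_coeff F n = fourier_coeff (\<lambda>z. b z * h z) n" if "n \<ge> 0" for n
    using b F h that
    by (intro ext_disk_eq_imp_fourier_coeff_eq L2_circ_L1 F H2_L2 Hinf_mult_H2 inner_fun_Hinf)
  with h that show ?thesis by blast
qed

text \<open>This takes the place of density of the span of the kernels. \<open>F - b * h\<close> has
  only negative coefficients and \<open>cnj g\<close> only nonpositive ones, so their product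
  integrates to zero; \<open>b * h\<close> is orthogonal to \<open>g\<close> by definition of the
  model space.\<close>

lemma orthogonal_kernels_imp_orthogonal:
  assumes b: "inner_fun b" and F: "L2_circ F"
    and orth: "\<And>w. cmod w < 1 \<Longrightarrow> ip_circ F (repr_kernel b w) = 0"
    and g: "model_space b g"
  shows "ip_circ F g = 0"
proof -
  obtain h where h: "H2 h" and fc: "\<And>n. n \<ge> 0 \<Longrightarrow> fourier_coeff F n = fourier_coeff (\<lambda>z. b z * h z) n"
    using orthogonal_kernels_imp_fourier_coeff[OF b F orth] by blast
  let ?bh = "\<lambda>z. b z * h z"
  have bh: "L2_circ ?bh"
    using b h by (intro H2_L2 Hinf_mult_H2 inner_fun_Hinf)
  have gH2: "H2 g" using g by (simp add: model_space_def)
  have g2: "L2_circ (\<lambda>z. cnj (g z))"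
    using gH2 by (intro L2_circ_cnj H2_L2)
  have "circ_int (\<lambda>z. (F z - ?bh z) * cnj (g z)) = 0"
  proof (rule circ_int_mult_eq_0[OF L2_circ_diff[OF F bh] g2])
    fix n :: int
    show "fourier_coeff (\<lambda>z. F z - ?bh z) n = 0 \<or> fourier_coeff (\<lambda>z. cnj (g z)) (- n) = 0"
      using fc[of n] gH2 F bh
      by (cases "n \<ge> 0") (auto simp: fourier_coeff_diff L2_circ_L1 fourier_coeff_cnj H2_def)
  qed
  then have "ip_circ F g = ip_circ ?bh g"
    using F bh g2 unfolding ip_circ_def by (simp add: left_diff_distrib circ_int_diff L2_circ_mult_L1)
  also have "\<dots> = cnj (ip_circ g ?bh)"
    unfolding ip_circ_def circ_int_cnj[symmetric] by (simp add: mult.commute)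
  also have "ip_circ g ?bh = 0"
    using g h by (simp add: model_space_def)
  finally show ?thesis by simp
qed

section \<open>Backward shift on model spaces and the kernel at the origin\<close>

definition backward_shift :: "(complex \<Rightarrow> complex) \<Rightarrow> complex \<Rightarrow> complex" where
  "backward_shift f z = z powi (-1) * (f z - fourier_coeff f 0)"

lemma H2_backward_shift:
  assumes "H2 f"
  shows "H2 (backward_shift f)"
proof -
  have "L2_circ (backward_shift f)"
    unfolding backward_shift_def[abs_def] using assms
    by (intro L2_circ_continuous_mult continuous_powi_circ L2_circ_diff H2_L2 H2_const)
  \<comment> \<open>At \<open>n = -1\<close> this is the coefficient of \<open>f - f(0)\<close> at
    0, which the subtraction has removed.\<close>
  moreover have "fourier_coeff (backward_shift f) n = 0" if "n < 0" for n
    unfolding backward_shift_def[abs_def] fourier_coeff_shift using assms that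
    by (cases "n = -1") (auto simp: fourier_coeff_diff L2_circ_L1 fourier_coeff_const H2_def)
  ultimately show ?thesis by (simp add: H2_def)
qed

text \<open>On the circle \<open>z powi (-1)\<close> is \<open>cnj z\<close> and can be moved to the
  second argument, so the shift of \<open>f\<close> paired with \<open>a * h\<close> becomes
  \<open>f - f(0)\<close> paired with \<open>a\<close> times \<open>z * h\<close>.\<close>

lemma model_space_inf_backward_shift:
  assumes a: "inner_fun a" and f: "model_space_inf a f"
  shows "model_space_inf a (backward_shift f)"
proof -
  define c where "c = fourier_coeff f 0"
  have fH: "Hinf f" "H2 f" and orth: "\<And>h. H2 h \<Longrightarrow> ip_circ f (\<lambda>z. a z * h z) = 0"
    using f by (auto simp: model_space_inf_def model_space_def)
  have S: "H2 (backward_shift f)"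
    by (rule H2_backward_shift[OF fH(2)])
  have "Hinf (\<lambda>z. f z - c)"
    using fH by (intro Hinf_diff Hinf_const)
  then obtain B where "circ_ae (\<lambda>z. cmod (f z - c) \<le> B)"
    by (auto simp: Hinf_def)
  then have "circ_ae (\<lambda>z. cmod (backward_shift f z) \<le> B)"
    by (simp add: circ_ae_eq backward_shift_def c_def norm_mult norm_inverse)
  with S have "Hinf (backward_shift f)"
    by (auto simp: Hinf_def)
  moreover have "ip_circ (backward_shift f) (\<lambda>z. a z * h z) = 0" if h: "H2 h" for h
  proof -
    let ?zh = "\<lambda>z. z * h z"
    have zh: "H2 ?zh" using H2_shift[OF h, of 1] by simp
    have azh: "L2_circ (\<lambda>z. a z * ?zh z)"
      by (rule H2_L2[OF Hinf_mult_H2[OF inner_fun_Hinf[OF a] zh]])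
    have "ip_circ (backward_shift f) (\<lambda>z. a z * h z) = circ_int (\<lambda>z. f z * cnj (a z * ?zh z) - c * cnj (a z * ?zh z))"
      unfolding ip_circ_def
    proof (rule circ_int_cong)
      fix z :: complex assume "cmod z = 1"
      then have "z powi (-1) = cnj z"
        using powi_circ_cnj[of z 1] by simp
      then show "backward_shift f z * cnj (a z * h z) = f z * cnj (a z * ?zh z) - c * cnj (a z * ?zh z)"
        unfolding backward_shift_def c_def by (simp add: algebra_simps)
    qed
    also have "\<dots> = ip_circ f (\<lambda>z. a z * ?zh z) - c * cnj (circ_int (\<lambda>z. a z * ?zh z))"
      unfolding ip_circ_def circ_int_cnj[symmetric] circ_int_cmult[symmetric]
      by (intro circ_int_diff L1_circ_cmult L2_circ_mult_L1[OF H2_L2[OF fH(2)]] L2_circ_L1 L2_circ_cnj azh)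
    \<comment> \<open>\<open>z * h\<close> vanishes at the origin, so its product with
      \<open>a\<close> has mean zero and the subtracted constant contributes nothing.\<close>
    also have "circ_int (\<lambda>z. a z * ?zh z) = 0"
    proof (rule circ_int_mult_eq_0)
      show "L2_circ a" "L2_circ ?zh"
        using a zh by (auto intro: H2_L2 Hinf_H2 inner_fun_Hinf)
      have "H2 a" using a by (intro Hinf_H2 inner_fun_Hinf)
      then show "fourier_coeff a n = 0 \<or> fourier_coeff ?zh (- n) = 0" for n
        using h fourier_coeff_shift[of 1 h "- n"] unfolding H2_def by (cases "n < 0") auto
    qed
    finally show ?thesis using orth[OF zh] by simp
  qed
  ultimately show ?thesis
    by (simp add: model_space_inf_def model_space_def Hinf_def)
qed

text \<open>The coefficient is \<open>1 - |a(0)|^2\<close>, which for unimodular boundary values is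
  also the squared norm of \<open>a - a(0)\<close>; were it zero, \<open>a\<close> would be constant
  almost everywhere.\<close>

lemma fourier_coeff_repr_kernel_0:
  assumes a: "inner_fun a" and nc: "nonconstant a"
  shows "fourier_coeff (repr_kernel a 0) 0 \<noteq> 0"
proof
  define c where "c = fourier_coeff a 0"
  assume "fourier_coeff (repr_kernel a 0) 0 = 0"
  moreover have aL2: "L2_circ a"
    using a by (intro H2_L2 Hinf_H2 inner_fun_Hinf)
  have "fourier_coeff (repr_kernel a 0) 0 = 1 - cnj c * c"
    unfolding repr_kernel_def[abs_def] ext_disk_0 using aL2
    by (simp add: fourier_coeff_diff L2_circ_L1 L1_circ_cmult fourier_coeff_const fourier_coeff_cmult c_def)
  ultimately have cc: "cnj c * c = 1" by simp
  have int_a: "circ_int a = c"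
    by (simp add: c_def fourier_coeff_def)
  have "circ_int (\<lambda>z. a z * cnj (a z)) = circ_int (\<lambda>z. 1)"
  proof (rule circ_int_cong_ae)
    show "circ_ae (\<lambda>z. a z * cnj (a z) = 1)"
      using circ_ae_inner_cnj_mult[OF a, of "\<lambda>z. 1"] by (simp add: mult.commute)
  qed (use aL2 in \<open>auto intro!: meas_circ_mult meas_circ_cnj L2_circ_meas[OF L2_circ_const]\<close>)
  also have "\<dots> = 1"
    using fourier_coeff_const[of 1 0] by (simp add: fourier_coeff_def)
  finally have aa: "circ_int (\<lambda>z. a z * cnj (a z)) = 1" .
  have "complex_of_real (normsq_circ (\<lambda>z. a z - c)) =
      circ_int (\<lambda>z. (a z * cnj (a z) - cnj c * a z) - (c * cnj (a z) - c * cnj c))"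
    unfolding circ_int_mult_cnj[symmetric] by (intro circ_int_cong) (simp add: algebra_simps)
  also have "\<dots> = (circ_int (\<lambda>z. a z * cnj (a z)) - cnj c * circ_int a) - (c * cnj (circ_int a) - circ_int (\<lambda>z. c * cnj c))"
    using aL2
    by (simp add: circ_int_diff L1_circ_diff L1_circ_cmult L2_circ_mult_L1 L2_circ_L1 L2_circ_cnj circ_int_cnj)
  also have "circ_int (\<lambda>z. c * cnj c) = c * cnj c"
    using fourier_coeff_const[of "c * cnj c" 0] by (simp add: fourier_coeff_def)
  finally have "normsq_circ (\<lambda>z. a z - c) = 0"
    using cc by (simp add: aa int_a mult.commute)
  then have "circ_ae (\<lambda>z. a z - c = 0)"
    by (intro normsq_circ_eq_0 L2_circ_diff aL2 L2_circ_const)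
  then have "circ_ae (\<lambda>z. a z = c)"
    by (auto elim: circ_ae_mono)
  with nc show False by (auto simp: nonconstant_def)
qed

subsection \<open>Symbols of the zero operator\<close>

lemma atto_eq: "atto a b p f w = circ_int (\<lambda>z. p z * f z * cnj (repr_kernel b w z))"
  by (simp add: atto_def proj_model_def ip_circ_def)

lemma Hinf_L2: "Hinf f \<Longrightarrow> L2_circ f"
  by (intro H2_L2 Hinf_H2)

lemma atto_eq_0_of_symbol:
  assumes a: "inner_fun a" and b: "inner_fun b" and p: "L2_circ p"
    and h1: "H2 h1" and h2: "H2 h2"
    and eq: "circ_ae (\<lambda>z. p z = cnj (a z * h1 z) + b z * h2 z)"
    and f: "model_space_inf a f" and w: "cmod w < 1"
  shows "atto a b p f w = 0"
proof -
  let ?k = "repr_kernel b w"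
  have k: "Hinf ?k" "H2 ?k" "\<And>h. H2 h \<Longrightarrow> ip_circ ?k (\<lambda>z. b z * h z) = 0"
    using model_space_inf_repr_kernel[OF b w] by (auto simp: model_space_inf_def model_space_def)
  have fH: "Hinf f" "\<And>h. H2 h \<Longrightarrow> ip_circ f (\<lambda>z. a z * h z) = 0"
    using f by (auto simp: model_space_inf_def model_space_def)
  \<comment> \<open>Boundedness of \<open>f\<close> and of the kernel keeps these products in H2, so
    that the orthogonality relations of both model spaces apply to them.\<close>
  have kh: "H2 (\<lambda>z. ?k z * h1 z)" and fh: "H2 (\<lambda>z. f z * h2 z)"
    using k(1) fH(1) h1 h2 by (auto intro: Hinf_mult_H2)
  have aH: "Hinf a" and bH: "Hinf b"
    using a b by (auto intro: inner_fun_Hinf)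
  have akh: "L2_circ (\<lambda>z. a z * (?k z * h1 z))"
    by (rule H2_L2[OF Hinf_mult_H2[OF aH kh]])
  have bfh: "L2_circ (\<lambda>z. b z * (f z * h2 z))"
    by (rule H2_L2[OF Hinf_mult_H2[OF bH fh]])
  have ah: "L2_circ (\<lambda>z. cnj (a z * h1 z))"
    by (rule L2_circ_cnj[OF H2_L2[OF Hinf_mult_H2[OF aH h1]]])
  have bh: "L2_circ (\<lambda>z. b z * h2 z)"
    by (rule H2_L2[OF Hinf_mult_H2[OF bH h2]])
  have "atto a b p f w = circ_int (\<lambda>z. (cnj (a z * h1 z) + b z * h2 z) * f z * cnj (?k z))"
    unfolding atto_eq
  proof (rule circ_int_cong_ae)
    show "meas_circ (\<lambda>z. p z * f z * cnj (?k z))"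
      using p fH(1) k(1) by (intro meas_circ_mult meas_circ_cnj L2_circ_meas) (auto intro: Hinf_L2)
    show "meas_circ (\<lambda>z. (cnj (a z * h1 z) + b z * h2 z) * f z * cnj (?k z))"
      by (intro meas_circ_mult[OF meas_circ_mult] meas_circ_add L2_circ_meas[OF ah] L2_circ_meas[OF bh]
          meas_circ_cnj L2_circ_meas[OF Hinf_L2] fH k)
  qed (use eq in \<open>auto elim: circ_ae_mono\<close>)
  \<comment> \<open>Conjugated factors are regrouped so that each summand pairs a model space
    function with a multiple of its own inner function.\<close>
  also have "\<dots> = circ_int (\<lambda>z. f z * cnj (a z * (?k z * h1 z)) + b z * (f z * h2 z) * cnj (?k z))"
    by (intro circ_int_cong) (simp add: algebra_simps)
  also have "\<dots> = ip_circ f (\<lambda>z. a z * (?k z * h1 z)) + ip_circ (\<lambda>z. b z * (f z * h2 z)) ?k"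
    unfolding ip_circ_def
    by (intro circ_int_add L2_circ_mult_L1 L2_circ_cnj akh bfh Hinf_L2[OF fH(1)] Hinf_L2[OF k(1)])
  also have "ip_circ (\<lambda>z. b z * (f z * h2 z)) ?k = cnj (ip_circ ?k (\<lambda>z. b z * (f z * h2 z)))"
    unfolding ip_circ_def circ_int_cnj[symmetric] by (simp add: mult.commute)
  finally show ?thesis
    using fH(2)[OF kh] k(3)[OF fh] by simp
qed

lemma symbol_of_atto_eq_0:
  assumes a: "inner_fun a" and b: "inner_fun b" and na: "nonconstant a" and nb: "nonconstant b"
    and p: "L2_circ p"
    and zero: "\<And>f w. model_space_inf a f \<Longrightarrow> cmod w < 1 \<Longrightarrow> atto a b p f w = 0"
  shows "\<exists>h1 h2. H2 h1 \<and> H2 h2 \<and> circ_ae (\<lambda>z. p z = cnj (a z * h1 z) + b z * h2 z)"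
proof -
  define c0 where "c0 = circ_int p"
  define U where "U f = circ_int (\<lambda>z. p z * f z)" for f
  define V where "V g = circ_int (\<lambda>z. p z * cnj (g z))" for g
  have Ha: "Hinf f" if "model_space_inf a f" for f
    using that by (simp add: model_space_inf_def)
  have Hb: "Hinf g" if "model_space_inf b g" for g
    using that by (simp add: model_space_inf_def)
  have pf: "L2_circ (\<lambda>z. p z * f z)" if "Hinf f" for f
    using Hinf_mult_L2[OF that p] by (simp add: mult.commute)
  \<comment> \<open>The hypothesis gives orthogonality of \<open>p * f\<close> to the kernels; it
    extends to every bounded function of the model space of \<open>b\<close>.\<close>
  have form: "circ_int (\<lambda>z. p z * f z * cnj (g z)) = 0"
    if f: "model_space_inf a f" and g: "model_space_inf b g" for f g
    using orthogonal_kernels_imp_orthogonal[OF b pf[OF Ha[OF f]], of g] zero[OF f] g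
    by (simp add: ip_circ_def atto_eq model_space_inf_def)
  have key: "fourier_coeff f 0 * V g + cnj (fourier_coeff g 0) * U f = fourier_coeff f 0 * cnj (fourier_coeff g 0) * c0"
    if f: "model_space_inf a f" and g: "model_space_inf b g" for f g
  proof -
    let ?c = "fourier_coeff f 0" and ?d = "cnj (fourier_coeff g 0)"
    have L: "L1_circ (\<lambda>z. p z * f z * cnj (g z))" "L1_circ (\<lambda>z. p z * cnj (g z))" "L1_circ (\<lambda>z. p z * f z)" "L1_circ p"
      using L2_circ_mult_L1[OF pf[OF Ha[OF f]] L2_circ_cnj[OF Hinf_L2[OF Hb[OF g]]]]
        L2_circ_mult_L1[OF p L2_circ_cnj[OF Hinf_L2[OF Hb[OF g]]]]
        L2_circ_L1[OF pf[OF Ha[OF f]]] L2_circ_L1[OF p] by auto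
    have "0 = circ_int (\<lambda>z. p z * backward_shift f z * cnj (backward_shift g z))"
      using form model_space_inf_backward_shift[OF a f] model_space_inf_backward_shift[OF b g] by simp
    also have "\<dots> = circ_int (\<lambda>z. (p z * f z * cnj (g z) - ?c * (p z * cnj (g z))) - (?d * (p z * f z) - ?c * ?d * p z))"
    proof (rule circ_int_cong)
      fix z :: complex assume z: "cmod z = 1"
      \<comment> \<open>\<open>u\<close> will be \<open>z powi (-1)\<close>, which is unimodular on
        the circle, so the factors from the two shifts cancel.\<close>
      have *: "p z * (u * x) * (cnj u * y) = p z * x * y" if "u * cnj u = 1" for u x y
      proof -
        have "p z * (u * x) * (cnj u * y) = (u * cnj u) * (p z * x * y)"
          by (simp only: mult_ac)
        with that show ?thesis by simp
      qed
      have "z powi (-1) * cnj (z powi (-1)) = 1"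
        using z complex_norm_square[of "z powi (-1)"] by (simp add: norm_inverse)
      then have "p z * backward_shift f z * cnj (backward_shift g z) = p z * (f z - ?c) * cnj (g z - fourier_coeff g 0)"
        using * unfolding backward_shift_def complex_cnj_mult by blast
      then show "p z * backward_shift f z * cnj (backward_shift g z) =
          (p z * f z * cnj (g z) - ?c * (p z * cnj (g z))) - (?d * (p z * f z) - ?c * ?d * p z)"
        by (simp add: algebra_simps)
    qed
    also have "\<dots> = (circ_int (\<lambda>z. p z * f z * cnj (g z)) - ?c * V g) - (?d * U f - ?c * ?d * c0)"
      using L by (simp add: U_def V_def c0_def circ_int_diff L1_circ_diff L1_circ_cmult)
    finally show ?thesis
      using form[OF f g] by (simp add: algebra_simps)
  qed
  let ?k = "repr_kernel a 0" and ?l = "repr_kernel b 0"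
  have k: "model_space_inf a ?k" and l: "model_space_inf b ?l"
    using a b by (auto intro: model_space_inf_repr_kernel)
  have k0: "fourier_coeff ?k 0 \<noteq> 0" and l0: "fourier_coeff ?l 0 \<noteq> 0"
    by (rule fourier_coeff_repr_kernel_0[OF a na], rule fourier_coeff_repr_kernel_0[OF b nb])
  \<comment> \<open>\<open>key\<close> with \<open>g = ?l\<close> is solved for \<open>U f\<close>,
    and with \<open>f = ?k\<close> for \<open>V g\<close>; \<open>l0\<close> and \<open>k0\<close>
    permit the divisions.\<close>
  define c where "c = c0 - V ?l / cnj (fourier_coeff ?l 0)"
  define d where "d = c0 - U ?k / fourier_coeff ?k 0"
  have U: "U f = c * fourier_coeff f 0" if "model_space_inf a f" for f
    using key[OF that l] l0 unfolding c_def by (simp add: field_simps)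
  have V: "V g = d * cnj (fourier_coeff g 0)" if "model_space_inf b g" for g
    using key[OF k that] k0 unfolding d_def by (simp add: field_simps)
  \<comment> \<open>\<open>U ?k\<close> is \<open>c\<close> times the coefficient of
    \<open>?k\<close> at 0, and by the choice of \<open>d\<close> it is also \<open>c0 - d\<close>
    times that nonzero number.\<close>
  have cd: "c + d = c0"
    using U[OF k] k0 unfolding d_def by simp
  have int1: "circ_int f = fourier_coeff f 0" for f
    by (simp add: fourier_coeff_def)
  have F1: "L2_circ (\<lambda>z. p z - d)" and F2: "L2_circ (\<lambda>z. cnj (p z) - cnj c)"
    using p by (auto intro!: L2_circ_diff L2_circ_cnj)
  have "ip_circ (\<lambda>z. p z - d) (repr_kernel b w) = 0" if "cmod w < 1" for w
  proof -
    let ?g = "repr_kernel b w"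
    have g: "model_space_inf b ?g" by (rule model_space_inf_repr_kernel[OF b that])
    have "ip_circ (\<lambda>z. p z - d) ?g = V ?g - d * cnj (circ_int ?g)"
      unfolding V_def ip_circ_def left_diff_distrib circ_int_cnj[symmetric] circ_int_cmult[symmetric]
      by (intro circ_int_diff L1_circ_cmult L2_circ_L1 L2_circ_mult_L1 L2_circ_cnj p Hinf_L2 Hb g)
    then show ?thesis using V[OF g] by (simp add: int1)
  qed
  then obtain h2 where h2: "H2 h2"
    and c2: "\<And>n. n \<ge> 0 \<Longrightarrow> fourier_coeff (\<lambda>z. p z - d) n = fourier_coeff (\<lambda>z. b z * h2 z) n"
    using orthogonal_kernels_imp_fourier_coeff[OF b F1] by blast
  have "ip_circ (\<lambda>z. cnj (p z) - cnj c) (repr_kernel a w) = 0" if "cmod w < 1" for w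
  proof -
    let ?f = "repr_kernel a w"
    have f: "model_space_inf a ?f" by (rule model_space_inf_repr_kernel[OF a that])
    have "ip_circ (\<lambda>z. cnj (p z) - cnj c) ?f = cnj (circ_int (\<lambda>z. p z * ?f z - c * ?f z))"
      unfolding ip_circ_def circ_int_cnj[symmetric] by (intro circ_int_cong) (simp add: algebra_simps)
    also have "circ_int (\<lambda>z. p z * ?f z - c * ?f z) = U ?f - c * circ_int ?f"
      unfolding U_def circ_int_cmult[symmetric]
      by (intro circ_int_diff L1_circ_cmult L2_circ_L1[OF Hinf_L2] L2_circ_mult_L1 p Hinf_L2 Ha f)
    finally show ?thesis using U[OF f] by (simp add: int1)
  qed
  then obtain h1 where h1: "H2 h1"
    and c1: "\<And>n. n \<ge> 0 \<Longrightarrow> fourier_coeff (\<lambda>z. cnj (p z) - cnj c) n = fourier_coeff (\<lambda>z. a z * h1 z) n"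
    using orthogonal_kernels_imp_fourier_coeff[OF a F2] by blast
  have ah: "H2 (\<lambda>z. a z * h1 z)" and bh: "H2 (\<lambda>z. b z * h2 z)"
    using a b h1 h2 by (auto intro: Hinf_mult_H2 inner_fun_Hinf)
  have ah2: "L2_circ (\<lambda>z. cnj (a z * h1 z))"
    by (rule L2_circ_cnj[OF H2_L2[OF ah]])
  have sum2: "L2_circ (\<lambda>z. cnj (a z * h1 z) + b z * h2 z)"
    by (rule L2_circ_add[OF ah2 H2_L2[OF bh]])
  \<comment> \<open>Subtracting the constant \<open>d\<close> changes only the coefficient at 0;
    negative coefficients vanish because \<open>b * h2\<close> lies in H2.\<close>
  have e2: "fourier_coeff (\<lambda>z. b z * h2 z) n = (if n > 0 then fourier_coeff p n else if n = 0 then c0 - d else 0)" for n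
    using c2[of n] bh p
    by (auto simp: fourier_coeff_diff L2_circ_L1 fourier_coeff_const H2_def c0_def int1)
  have e1: "fourier_coeff (\<lambda>z. a z * h1 z) n =
      (if n > 0 then cnj (fourier_coeff p (- n)) else if n = 0 then cnj (c0 - c) else 0)" for n
    using c1[of n] ah p
    by (auto simp: fourier_coeff_diff L2_circ_L1 L2_circ_cnj fourier_coeff_cnj fourier_coeff_const H2_def c0_def int1)
  have "fourier_coeff (\<lambda>z. p z - (cnj (a z * h1 z) + b z * h2 z)) n = 0" for n
  proof -
    have "fourier_coeff (\<lambda>z. p z - (cnj (a z * h1 z) + b z * h2 z)) n =
        fourier_coeff p n - (cnj (fourier_coeff (\<lambda>z. a z * h1 z) (- n)) + fourier_coeff (\<lambda>z. b z * h2 z) n)"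
      unfolding fourier_coeff_cnj[symmetric]
      using fourier_coeff_diff[OF L2_circ_L1[OF p] L2_circ_L1[OF sum2]]
        fourier_coeff_add[OF L2_circ_L1[OF ah2] L2_circ_L1[OF H2_L2[OF bh]]]
      by simp
    \<comment> \<open>Index 0 is the only one to which both summands can contribute, and there
      \<open>(c0 - c) + (c0 - d) = c0\<close> because \<open>c + d = c0\<close>.\<close>
    also have "\<dots> = 0"
      using cd unfolding e1 e2 by (cases n "0::int" rule: linorder_cases) (auto simp: c0_def int1)
    finally show ?thesis .
  qed
  then have "circ_ae (\<lambda>z. p z - (cnj (a z * h1 z) + b z * h2 z) = 0)"
    by (intro fourier_coeff_unique_zero L2_circ_L1 L2_circ_diff p sum2)
  then have "circ_ae (\<lambda>z. p z = cnj (a z * h1 z) + b z * h2 z)"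
    by (rule circ_ae_mono) simp
  with h1 h2 show ?thesis by blast
qed

theorem theorem2p1:
  fixes \<alpha> \<beta> \<phi> :: "complex \<Rightarrow> complex"
  assumes "inner_fun \<alpha>" and "inner_fun \<beta>"
    and "nonconstant \<alpha>" and "nonconstant \<beta>"
    and "L2_circ \<phi>"
    and "atto_bounded \<alpha> \<beta> \<phi>"
  shows "(\<forall>f. model_space_inf \<alpha> f \<longrightarrow> (\<forall>w\<in>ball 0 1. atto \<alpha> \<beta> \<phi> f w = 0)) \<longleftrightarrow>
         (\<exists>h1 h2. H2 h1 \<and> H2 h2 \<and> circ_ae (\<lambda>z. \<phi> z = cnj (\<alpha> z * h1 z) + \<beta> z * h2 z))"
proof
  assume "\<forall>f. model_space_inf \<alpha> f \<longrightarrow> (\<forall>w\<in>ball 0 1. atto \<alpha> \<beta> \<phi> f w = 0)"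
  then show "\<exists>h1 h2. H2 h1 \<and> H2 h2 \<and> circ_ae (\<lambda>z. \<phi> z = cnj (\<alpha> z * h1 z) + \<beta> z * h2 z)"
    using assms by (intro symbol_of_atto_eq_0) auto
next
  assume "\<exists>h1 h2. H2 h1 \<and> H2 h2 \<and> circ_ae (\<lambda>z. \<phi> z = cnj (\<alpha> z * h1 z) + \<beta> z * h2 z)"
  then show "\<forall>f. model_space_inf \<alpha> f \<longrightarrow> (\<forall>w\<in>ball 0 1. atto \<alpha> \<beta> \<phi> f w = 0)"
    using atto_eq_0_of_symbol assms by auto
qed

end
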